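(* Consider the generalized average aggregative game defined in the context, with its standing assumptions. Choose $\gamma_i>0$ for $i\in\{1,\dots,N\}$, put $\hat\gamma:=\frac1N\sum_{i=1}^N\gamma_i$, and choose $\alpha>0$, $\delta_{\mathrm c}\in(0,\frac{1}{\hat\gamma})$ and $\beta_{\mathrm c}\in\big(0,\frac{1}{\alpha+\hat\gamma/N}\big)$. For arbitrary initial data $x_i^0\in\Omega_i$, $y_i^0=A_ix_i^0-b_i$ ($i=1,\dots,N$), $\sigma^0=M_n\boldsymbol x^0$, $\mu^0=0\in\mathbb R^n$, $\lambda^0\in\mathbb R^m_{\ge0}$, define iteratively for $k=0,1,2,\dots$ (Algorithm 1): for all $i\in\{1,\dots,N\}$ $$x_i^{k+1}=\operatorname*{argmin}_{z\in\Omega_i}\; f_i(z,\sigma^k)+\big(A_i^\top\lambda^k-\tfrac1N\mu^k\big)^\top z+\tfrac{1}{2\gamma_i}\|z-x_i^k\|^2_{(I+A_i^\top A_i)},\qquad y_i^{k+1}=A_ix_i^{k+1}-b_i,$$ and, with $\hat x^k:=\frac1N\sum_{j=1}^Nx_j^k$ and $\hat y^k:=\frac1N\sum_{j=1}^Ny_j^k$, $$\lambda^{k+1}=\mathrm{proj}_{\mathbb R^m_{\ge0}}\big(\lambda^k+\delta_{\mathrm c}(2\hat y^{k+1}-\hat y^k)\big),$$ $$\mu^{k+1}=\mu^k-\beta_{\mathrm c}\big(2\hat x^{k+1}-\hat x^k-\sigma^k+\alpha\mu^k\big),$$ $$\sigma^{k+1}=\sigma^k-\alpha\mu^{k+1}.$$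 Then the sequence $\big(\mathrm{col}(\boldsymbol x^k,\boldsymbol y^k,\sigma^k,\mu^k,\lambda^k)\big)_{k=0}^\infty$ globally converges to some $\mathrm{col}(\boldsymbol x^*,\boldsymbol y^*,\sigma^*,\mu^*,\lambda^* )\in\mathrm{zer}(\mathcal T)$, where $\boldsymbol x^*$ is a variational generalized aggregative equilibrium (v-GAE) of the game.
   Context: Notation. $\overline{\mathbb R}=\mathbb R\cup\{\infty\}$; $\mathrm{col}$ denotes vertical stacking; $\boldsymbol x=\mathrm{col}(x_1,\dots,x_N)$ with $x_i\in\mathbb R^n$; $\boldsymbol y=\mathrm{col}(y_1,\dots,y_N)$ with $y_i\in\mathbb R^m$; $\boldsymbol x_{-i}=\mathrm{col}(\{x_j\}_{j\ne i})$; $M_n:=\frac1N\mathbf 1_N^\top\otimes I_n$ and $M_m:=\frac1N\mathbf 1_N^\top\otimes I_m$ (so $M_n\boldsymbol x=\frac1N\sum_ix_i$). $\|v\|_Q^2=v^\top Qv$. For $\psi:\mathbb R^p\to\overline{\mathbb R}$, $\mathrm{dom}(\psi)=\{x\mid\psi(x)<\infty\}$ and, for $x\in\mathrm{dom}(\psi)$, $\partial\psi(x)=\{v\mid\psi(z)\ge\psi(x)+v^\top(z-x)\ \forall z\in\mathrm{dom}(\psi)\}$ (empty for $x\notin\mathrm{dom}(\psi)$). $\mathrm N_S$ is the normal cone operator of a set $S$ (empty outside $S$), which is the subdifferential of the indicator function $\iota_S$. $\mathrm{zer}(\mathcal F)=\{x\mid 0\in\mathcal F(x)\}$. Game. There are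 $N$ agents; agent $i$ has decision set $\Omega_i\subseteq\mathbb R^n$ and cost $J_i(x_i,\boldsymbol x_{-i})=f_i(x_i,M_n\boldsymbol x)$ with $f_i:\mathbb R^n\times\mathbb R^n\to\overline{\mathbb R}$. The coupling constraint is $A\boldsymbol x\le b$ with $A=[A_1,\dots,A_N]$, $A_i\in\mathbb R^{m\times n}$, $b=\sum_{i=1}^Nb_i\in\mathbb R^m$. The collective feasible set is $\boldsymbol{\mathcal X}=\prod_{i=1}^N\Omega_i\cap\{\boldsymbol x\in\mathbb R^{nN}\mid A\boldsymbol x-b\le0\}$. Agent $i$ solves $\min_{x_i}J_i(x_i,\boldsymbol x_{-i})$ subject to $x_i\in\Omega_i$ and $A_ix_i-b_i\le\sum_{j\ne i}(b_j-A_jx_j)$. GVI. For a closed convex set $W$ and a set-valued mapping $\Psi$ on $W$, a solution of $\mathrm{GVI}(W,\Psi)$ is a point $x^*\in W$ for which there is $g^*\in\Psi(x^* )$ with $(x-x^* )^\top g^*\ge0$ for all $x\in W$. v-GAE. $\bar{\boldsymbol x}$ is a v-GAE of the game if it solves $\mathrm{GVI}(\boldsymbol{\mathcal X},F_{\mathrm a})$, where $F_{\mathrm a}(\boldsymbol x)=\mathrm{col}\big(\{\partial_{x_i}f_i(x_i,z)|_{z=M_n\boldsymbol x}\}_{i=1}^N\big)$. Operator $\mathcal T$. Let $F_{\mathrm e}(\boldsymbol x,\sigma)=\mathrm{col}\big(\{\partial_{x_i}f_i(x_i,\sigma)\}_{i=1}^N\big)$ (subdifferential in the first argument, $\sigma\in\mathbb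 R^n$ fixed), $C_i=\{(x_i,y_i)\in\Omega_i\times\mathbb R^m\mid y_i=A_ix_i-b_i\}$, $\boldsymbol C=\{(\boldsymbol x,\boldsymbol y)\mid(x_i,y_i)\in C_i\ \forall i\}$. For $(\boldsymbol x,\boldsymbol y,\sigma,\mu,\lambda)\in\mathbb R^{nN}\times\mathbb R^{mN}\times\mathbb R^n\times\mathbb R^n\times\mathbb R^m$, $\mathcal T(\boldsymbol x,\boldsymbol y,\sigma,\mu,\lambda)$ is the set of all vectors $$\mathrm{col}\big(g+p-M_n^\top\mu,\ \ q+M_m^\top\lambda,\ \ \mu,\ \ -(\sigma-M_n\boldsymbol x),\ \ r-M_m\boldsymbol y\big)$$ with $g\in F_{\mathrm e}(\boldsymbol x,\sigma)$, $(p,q)\in\mathrm N_{\boldsymbol C}(\boldsymbol x,\boldsymbol y)$, $r\in\mathrm N_{\mathbb R^m_{\ge0}}(\lambda)$. Standing assumptions. (1) Each $\Omega_i$ is nonempty, compact and convex, and $\boldsymbol{\mathcal X}$ satisfies Slater's constraint qualification. (2) For all $i$, all $\boldsymbol z\in\prod_{j\ne i}\Omega_j$ and all $w\in\frac1N\sum_{j\ne i}\Omega_j$, the functions $J_i(\cdot,\boldsymbol z)$ and $f_i(\cdot,w)$ are convex. (3) The set-valued mapping $(\boldsymbol x,\sigma)\mapsto F_{\mathrm e}(\boldsymbol x,\sigma)\times\{0_n\}$ on $\mathbb R^{nN}\times\mathbb R^n$ is maximally monotone.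
   Formalization: The limit lies in zer(T) with λ* replaced by Nλ* (the literal claim fails for N≥2), and Slater's condition asks for a strictly feasible point with each x_i in the relative interiors of Ω_i and of dom f_i(·,M_n x), since costs may be infinite. *)

theory Defs
  imports "HOL-Analysis.Analysis"
begin

text \<open>
  Agents are the elements of a finite type \<open>'N\<close>, with \<open>N = CARD('N)\<close>. A stacked vector
  \<open>col(x_1, ..., x_N)\<close> with blocks in \<open>R^n\<close> is an element of \<open>(real ^ 'n) ^ 'N\<close>.
  Extended-valued functions take values in \<^typ>\<open>ereal\<close>; the value \<open>-\<infinity>\<close> is excluded
  by a hypothesis where needed.
\<close>

section \<open>Convex analysis and set-valued operators\<close>

definition edom :: "('a \<Rightarrow> ereal) \<Rightarrow> 'a set" where
  "edom \<psi> = {x. \<psi> x < \<infinity>}"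

definition convex_fun :: "('a::real_vector \<Rightarrow> ereal) \<Rightarrow> bool" where
  "convex_fun \<psi> \<longleftrightarrow>
     (\<forall>x y t. 0 < t \<and> t < 1 \<longrightarrow>
        \<psi> ((1 - t) *\<^sub>R x + t *\<^sub>R y) \<le> ereal (1 - t) * \<psi> x + ereal t * \<psi> y)"

definition subdiff :: "('a::real_inner \<Rightarrow> ereal) \<Rightarrow> 'a \<Rightarrow> 'a set" where
  "subdiff \<psi> x =
     (if x \<in> edom \<psi> then {v. \<forall>z\<in>edom \<psi>. \<psi> z \<ge> \<psi> x + ereal (v \<bullet> (z - x))} else {})"

definition normal_cone :: "'a::real_inner set \<Rightarrow> 'a \<Rightarrow> 'a set" where
  "normal_cone S x = (if x \<in> S then {v. \<forall>z\<in>S. v \<bullet> (z - x) \<le> 0} else {})"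

definition zer :: "('a \<Rightarrow> 'b::zero set) \<Rightarrow> 'a set" where
  "zer F = {x. 0 \<in> F x}"

definition monotone_op :: "('a::real_inner \<Rightarrow> 'a set) \<Rightarrow> bool" where
  "monotone_op F \<longleftrightarrow> (\<forall>x y. \<forall>u\<in>F x. \<forall>v\<in>F y. (x - y) \<bullet> (u - v) \<ge> 0)"

definition maximally_monotone :: "('a::real_inner \<Rightarrow> 'a set) \<Rightarrow> bool" where
  "maximally_monotone F \<longleftrightarrow>
     monotone_op F \<and> (\<forall>G. monotone_op G \<and> (\<forall>x. F x \<subseteq> G x) \<longrightarrow> G = F)"

definition solves_GVI :: "'a::real_inner set \<Rightarrow> ('a \<Rightarrow> 'a set) \<Rightarrow> 'a \<Rightarrow> bool" where
  "solves_GVI W \<Psi> x \<longleftrightarrow> x \<in> W \<and> (\<exists>g\<in>\<Psi> x. \<forall>z\<in>W. (z - x) \<bullet> g \<ge> 0)"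

definition wnorm_sq :: "real ^ 'n ^ 'n \<Rightarrow> real ^ 'n \<Rightarrow> real" where
  "wnorm_sq Q v = v \<bullet> (Q *v v)"

definition nonneg_orthant :: "(real ^ 'm) set" where
  "nonneg_orthant = {l. \<forall>j. 0 \<le> l $ j}"


section \<open>The aggregative game\<close>

text \<open>\<open>avg\<close> is \<open>M_n\<close> (or \<open>M_m\<close>, depending on the block type), \<open>avg_transp\<close> its transpose.\<close>

definition avg :: "(real ^ 'n) ^ 'N::finite \<Rightarrow> real ^ 'n" where
  "avg x = (1 / real CARD('N)) *\<^sub>R (\<Sum>i\<in>UNIV. x $ i)"

definition avg_transp :: "real ^ 'n \<Rightarrow> (real ^ 'n) ^ 'N::finite" where
  "avg_transp u = (\<chi> i. (1 / real CARD('N)) *\<^sub>R u)"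

lemma avg_transp_adjoint:
  fixes x :: "(real ^ 'n) ^ 'N::finite"
  shows "avg x \<bullet> u = x \<bullet> avg_transp u"
  by (simp add: avg_def avg_transp_def inner_vec_def[of x] inner_sum_left sum_divide_distrib)

text \<open>In \<open>cost f i u z\<close> the own decision is \<open>u\<close>; the \<open>i\<close>-th block of \<open>z\<close> is ignored.\<close>

definition cost ::
  "('N::finite \<Rightarrow> real ^ 'n \<Rightarrow> real ^ 'n \<Rightarrow> ereal) \<Rightarrow> 'N \<Rightarrow> real ^ 'n \<Rightarrow> (real ^ 'n) ^ 'N \<Rightarrow> ereal"
  where
  "cost f i u z = f i u (avg (\<chi> j. if j = i then u else z $ j))"

definition others_avg :: "('N::finite \<Rightarrow> (real ^ 'n) set) \<Rightarrow> 'N \<Rightarrow> (real ^ 'n) set" where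
  "others_avg \<Omega> i =
     {(1 / real CARD('N)) *\<^sub>R (\<Sum>j\<in>UNIV - {i}. z j) | z. \<forall>j\<in>UNIV - {i}. z j \<in> \<Omega> j}"

definition feasible ::
  "('N::finite \<Rightarrow> (real ^ 'n) set) \<Rightarrow> ('N \<Rightarrow> real ^ 'n ^ 'm) \<Rightarrow> ('N \<Rightarrow> real ^ 'm)
     \<Rightarrow> ((real ^ 'n) ^ 'N) set" where
  "feasible \<Omega> A b =
     {x. (\<forall>i. x $ i \<in> \<Omega> i) \<and> (\<forall>j. (\<Sum>i\<in>UNIV. A i *v (x $ i)) $ j \<le> (\<Sum>i\<in>UNIV. b i) $ j)}"

text \<open>
  Slater's constraint qualification: a strictly feasible point in the relative interior of the
  domain of the problem. As the costs may take the value \<open>\<infinity>\<close>, this domain is determined by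
  both the sets \<open>\<Omega> i\<close> and the effective domains of the costs. If the costs are finite-valued, the
  condition amounts to the existence of a point of the product of the \<open>\<Omega> i\<close> satisfying the coupling
  constraints strictly (the \<open>\<Omega> i\<close> being convex).
\<close>

definition slater ::
  "('N::finite \<Rightarrow> real ^ 'n \<Rightarrow> real ^ 'n \<Rightarrow> ereal) \<Rightarrow> ('N \<Rightarrow> (real ^ 'n) set)
     \<Rightarrow> ('N \<Rightarrow> real ^ 'n ^ 'm) \<Rightarrow> ('N \<Rightarrow> real ^ 'm) \<Rightarrow> bool" where
  "slater f \<Omega> A b \<longleftrightarrow>
     (\<exists>x :: (real ^ 'n) ^ 'N.
        (\<forall>i. x $ i \<in> rel_interior (\<Omega> i) \<inter> rel_interior (edom (\<lambda>u. f i u (avg x)))) \<and>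
        (\<forall>j. (\<Sum>i\<in>UNIV. A i *v (x $ i)) $ j < (\<Sum>i\<in>UNIV. b i) $ j))"

definition F_e ::
  "('N::finite \<Rightarrow> real ^ 'n \<Rightarrow> real ^ 'n \<Rightarrow> ereal) \<Rightarrow> (real ^ 'n) ^ 'N \<Rightarrow> real ^ 'n
     \<Rightarrow> ((real ^ 'n) ^ 'N) set" where
  "F_e f x \<sigma> = {g. \<forall>i. g $ i \<in> subdiff (\<lambda>u. f i u \<sigma>) (x $ i)}"

definition F_a ::
  "('N::finite \<Rightarrow> real ^ 'n \<Rightarrow> real ^ 'n \<Rightarrow> ereal) \<Rightarrow> (real ^ 'n) ^ 'N
     \<Rightarrow> ((real ^ 'n) ^ 'N) set" where
  "F_a f x = {g. \<forall>i. g $ i \<in> subdiff (\<lambda>u. f i u (avg x)) (x $ i)}"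

definition v_GAE ::
  "('N::finite \<Rightarrow> real ^ 'n \<Rightarrow> real ^ 'n \<Rightarrow> ereal) \<Rightarrow> ('N \<Rightarrow> (real ^ 'n) set)
     \<Rightarrow> ('N \<Rightarrow> real ^ 'n ^ 'm) \<Rightarrow> ('N \<Rightarrow> real ^ 'm) \<Rightarrow> (real ^ 'n) ^ 'N \<Rightarrow> bool" where
  "v_GAE f \<Omega> A b x \<longleftrightarrow> solves_GVI (feasible \<Omega> A b) (F_a f) x"

definition C_loc ::
  "('N \<Rightarrow> (real ^ 'n) set) \<Rightarrow> ('N \<Rightarrow> real ^ 'n ^ 'm) \<Rightarrow> ('N \<Rightarrow> real ^ 'm) \<Rightarrow> 'N
     \<Rightarrow> ((real ^ 'n) \<times> (real ^ 'm)) set" where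
  "C_loc \<Omega> A b i = {(u, v). u \<in> \<Omega> i \<and> v = A i *v u - b i}"

definition C_glob ::
  "('N::finite \<Rightarrow> (real ^ 'n) set) \<Rightarrow> ('N \<Rightarrow> real ^ 'n ^ 'm) \<Rightarrow> ('N \<Rightarrow> real ^ 'm)
     \<Rightarrow> (((real ^ 'n) ^ 'N) \<times> ((real ^ 'm) ^ 'N)) set" where
  "C_glob \<Omega> A b = {(x, y). \<forall>i. (x $ i, y $ i) \<in> C_loc \<Omega> A b i}"

text \<open>
  The second row gives \<open>q_i = - \<lambda> / N\<close> at a zero, so the stationarity condition for \<open>x_i\<close> contains
  the multiplier term \<open>(A_i)^T \<lambda> / N\<close>. An iteration that uses \<open>(A_i)^T \<lambda>\<close> in its primal
  step therefore produces the \<open>\<lambda>\<close>-component of a zero divided by \<open>N\<close>.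
\<close>

definition T_op ::
  "('N::finite \<Rightarrow> real ^ 'n \<Rightarrow> real ^ 'n \<Rightarrow> ereal) \<Rightarrow> ('N \<Rightarrow> (real ^ 'n) set)
     \<Rightarrow> ('N \<Rightarrow> real ^ 'n ^ 'm) \<Rightarrow> ('N \<Rightarrow> real ^ 'm)
     \<Rightarrow> ((real ^ 'n) ^ 'N) \<times> ((real ^ 'm) ^ 'N) \<times> (real ^ 'n) \<times> (real ^ 'n) \<times> (real ^ 'm)
     \<Rightarrow> (((real ^ 'n) ^ 'N) \<times> ((real ^ 'm) ^ 'N) \<times> (real ^ 'n) \<times> (real ^ 'n) \<times> (real ^ 'm)) set" where
  "T_op f \<Omega> A b = (\<lambda>(x, y, \<sigma>, \<mu>, lam).
     {(g + p - avg_transp \<mu>, q + avg_transp lam, \<mu>, - (\<sigma> - avg x), r - avg y) | g p q r.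
        g \<in> F_e f x \<sigma> \<and> (p, q) \<in> normal_cone (C_glob \<Omega> A b) (x, y) \<and>
        r \<in> normal_cone nonneg_orthant lam})"

end

theory Submission
  imports Defs
begin

text \<open>
  As the second component of \<open>F_e(x, \<sigma>) \<times> {0}\<close> vanishes, the union of \<open>F_e(\<cdot>, \<sigma>) \<times> {0}\<close> over all
  \<open>\<sigma>\<close> is still monotone; maximality therefore forces \<open>F_e\<close> to be independent of \<open>\<sigma>\<close>, and \<open>F_e\<close> is a
  single maximally monotone subdifferential. Under Slater's condition, a separation argument
  gives Lagrange multipliers for minimisers over the compact set \<open>\<Omega>\<close>. This yields the zeros of \<open>T\<close>,
  the attainment of the proximal steps and, via resolvents, closedness of the graph of
  \<open>F_e + N\<^sub>\<Omega>\<close>.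

  Eliminating \<open>y\<close>, the algorithm is a proximal point iteration
  \<open>0 \<in> T(w\<^sup>+) + \<Phi>(w\<^sup>+ - w)\<close> with a symmetric \<open>\<Phi>\<close>, and completing squares shows that the step size
  bounds make \<open>\<Phi>\<close> positive definite. Hence the iterates are Fejer monotone in the \<open>\<Phi>\<close>-norm, the
  increments tend to zero, every cluster point is a zero of \<open>T\<close>, and so the whole sequence
  converges.
\<close>

section \<open>Separation and relative interiors\<close>

text \<open>If 0 lies outside the closure, strict separation applies. Otherwise 0 is in the closure
  but not in the relative interior, and a supporting hyperplane at the relative frontier is strictly
  positive on that interior. So the functional does not vanish identically on \<open>W\<close>, even
  if \<open>W\<close> has empty interior.\<close>

lemma proper_separation_0:
  fixes W :: "'a::euclidean_space set"
  assumes W: "convex W" "0 \<notin> W"  and ne: "W \<noteq> {}"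
  obtains a where "\<And>w. w \<in> W \<Longrightarrow> 0 \<le> a \<bullet> w" "\<exists>w\<in>W. a \<bullet> w \<noteq> 0"
proof (cases "0 \<in> closure W")
  case True
  have nri: "0 \<notin> rel_interior W" using W rel_interior_subset by blast
  then obtain a where a: "\<And>y. y \<in> closure W \<Longrightarrow> a \<bullet> 0 \<le> a \<bullet> y"
    "\<And>y. y \<in> rel_interior W \<Longrightarrow> a \<bullet> 0 < a \<bullet> y"
    using supporting_hyperplane_relative_frontier[OF \<open>convex W\<close> True nri] by metis
  obtain w where "w \<in> rel_interior W" using ne W rel_interior_eq_empty by blast
  then have "w \<in> W" "a \<bullet> w \<noteq> 0" using a(2)[of w] rel_interior_subset by auto
  moreover have "0 \<le> a \<bullet> w" if "w \<in> W" for w using a(1)[of w] that closure_subset by auto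
  ultimately show ?thesis using that by blast
next
  case False
  obtain a b where "a \<noteq> 0" "0 < b" "\<forall>x\<in>closure W. a \<bullet> x > b"
    using separating_hyperplane_closed_0[OF convex_closure[OF \<open>convex W\<close>] closed_closure False] by blast
  then have pos: "0 < a \<bullet> w" if "w \<in> W" for w using that closure_subset by fastforce
  obtain w where "w \<in> W" using ne by blast
  with pos[of w] have "\<exists>w\<in>W. a \<bullet> w \<noteq> 0" by force
  then show ?thesis using that[of a] pos less_imp_le by blast
qed

text \<open>From \<open>x\<close> one can step slightly beyond, away from \<open>z\<close>, without
  leaving \<open>S\<close>; a larger value at \<open>z\<close> would force a smaller one
  there.\<close>

lemma rel_interior_linear_minimum_const:
  fixes S :: "'a::euclidean_space set"
  assumes x: "x \<in> rel_interior S" and min: "\<And>z. z \<in> S \<Longrightarrow> a \<bullet> x \<le> a \<bullet> z" and z: "z \<in> S"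
  shows "a \<bullet> z = a \<bullet> x"
proof -
  obtain e where "x \<in> S" and e: "e > 0" "ball x e \<inter> affine hull S \<subseteq> S"
    using x by (auto simp: mem_rel_interior_ball)
  \<comment> \<open>The summand 1 keeps the denominator positive when \<open>z = x\<close>.\<close>
  define t where "t = e / (2 * (norm (x - z) + 1))"
  have t: "t > 0" "t * norm (x - z) < e"
    using e by (auto simp: t_def field_simps add_pos_nonneg intro!: add_nonneg_pos)
  define u where "u = x + t *\<^sub>R (x - z)"
  have "u = (1 + t) *\<^sub>R x + (- t) *\<^sub>R z" by (simp add: u_def algebra_simps)
  then have "u \<in> affine hull S"
    using mem_affine[OF affine_affine_hull hull_inc hull_inc, OF \<open>x \<in> S\<close> z, of "1 + t" "- t"] by simp
  moreover have "u \<in> ball x e" using t by (simp add: u_def dist_norm)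
  ultimately have "a \<bullet> x \<le> a \<bullet> u" using e min by blast
  then have "0 \<le> t * (a \<bullet> (x - z))" by (simp add: u_def inner_add_right)
  then have "a \<bullet> z \<le> a \<bullet> x" using t by (simp add: zero_le_mult_iff inner_diff_right)
  with min[OF z] show ?thesis by simp
qed

text \<open>The affine hull of the product lies in the product of the affine hulls, so the smallest
  of the finitely many radii serves all blocks.\<close>

lemma rel_interior_vec_prod:
  fixes S :: "'i::finite \<Rightarrow> 'a::euclidean_space set"
  assumes "\<And>i. x $ i \<in> rel_interior (S i)"
  shows "x \<in> rel_interior {x. \<forall>i. x $ i \<in> S i}"
proof -
  have "\<forall>i. \<exists>e>0. ball (x $ i) e \<inter> affine hull S i \<subseteq> S i" and xS: "\<forall>i. x $ i \<in> S i"
    using assms by (auto simp: mem_rel_interior_ball)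
  then obtain e where e: "\<And>i. e i > 0" "\<And>i. ball (x $ i) (e i) \<inter> affine hull S i \<subseteq> S i" by metis
  define m where "m = Min (range e)"
  have m: "m > 0" "\<And>i. m \<le> e i" using e by (auto simp: m_def)
  have aff: "affine hull {x. \<forall>i. x $ i \<in> S i} \<subseteq> {x. \<forall>i. x $ i \<in> affine hull S i}"
    by (intro hull_minimal) (auto simp: affine_def hull_inc intro!: mem_affine affine_affine_hull)
  have "ball x m \<inter> affine hull {x. \<forall>i. x $ i \<in> S i} \<subseteq> {x. \<forall>i. x $ i \<in> S i}"
  proof clarify
    fix u i assume u: "u \<in> ball x m" "u \<in> affine hull {x. \<forall>i. x $ i \<in> S i}"
    have "dist (x $ i) (u $ i) < e i"
      using u(1) m(2)[of i] dist_vec_nth_le[of x i u] by auto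
    moreover have "u $ i \<in> affine hull S i" using u(2) aff by blast
    ultimately show "u $ i \<in> S i" using e(2)[of i] by auto
  qed
  with m xS show ?thesis by (auto simp: mem_rel_interior_ball)
qed

section \<open>Subdifferentials and Lagrange multipliers\<close>

text \<open>Adjoining a pair that is monotonically related to the whole graph gives a monotone
  extension, which by maximality is \<open>F\<close> itself.\<close>

lemma maximally_monotone_mem:
  assumes F: "maximally_monotone F" and rel: "\<And>y w. w \<in> F y \<Longrightarrow> 0 \<le> (x - y) \<bullet> (v - w)"
  shows "v \<in> F x"
proof -
  define G where "G = F(x := insert v (F x))"
  have "0 \<le> (y - x) \<bullet> (w - v)" if "w \<in> F y" for y w
    using rel[OF that] by (simp add: inner_diff_left inner_diff_right)
  then have "monotone_op G"
    using F rel unfolding maximally_monotone_def monotone_op_def G_def by (auto split: if_splits)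
  moreover have "\<forall>x. F x \<subseteq> G x" by (auto simp: G_def)
  ultimately have "G = F" using F by (auto simp: maximally_monotone_def)
  then show ?thesis by (metis G_def fun_upd_same insertI1)
qed

lemma maximally_monotone_nonempty:
  assumes "maximally_monotone F" shows "\<exists>x v. v \<in> F x"
  using maximally_monotone_mem[OF assms, of 0 0] by blast

section \<open>Subgradients on an explicit domain and the closed epigraph\<close>

text \<open>The real-valued counterpart of \<open>subdiff\<close>, with the domain as an argument,
  so that sums over the agents avoid extended arithmetic.\<close>

definition subgrad :: "'a::real_inner set \<Rightarrow> ('a \<Rightarrow> real) \<Rightarrow> 'a \<Rightarrow> 'a set" where
  "subgrad D \<phi> x = {v. x \<in> D \<and> (\<forall>z\<in>D. \<phi> x + v \<bullet> (z - x) \<le> \<phi> z)}"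

text \<open>The epigraph of the supremum of all affine minorants that touch \<open>\<phi>\<close>. Nothing makes \<open>\<phi>\<close>
  itself lower semicontinuous, so minimisers are first sought on this closed convex set.\<close>
definition closed_epigraph :: "'a::real_inner set \<Rightarrow> ('a \<Rightarrow> real) \<Rightarrow> ('a \<times> real) set" where
  "closed_epigraph D \<phi> = {(z, t). \<forall>x. \<forall>v\<in>subgrad D \<phi> x. \<phi> x + v \<bullet> (z - x) \<le> t}"

lemma mem_closed_epigraph: "z \<in> D \<Longrightarrow> (z, \<phi> z) \<in> closed_epigraph D \<phi>"
  by (auto simp: closed_epigraph_def subgrad_def)

lemma closed_epigraph_halfspaces:
  "closed_epigraph D \<phi> = (\<Inter>(x, v) \<in> {(x, v). v \<in> subgrad D \<phi> x}. {w. (v, - 1) \<bullet> w \<le> v \<bullet> x - \<phi> x})"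
  by (auto simp: closed_epigraph_def inner_diff_right inner_prod_def algebra_simps)

lemma closed_closed_epigraph: "closed (closed_epigraph D \<phi>)"
  unfolding closed_epigraph_halfspaces by (intro closed_INT ballI) (auto simp: closed_halfspace_le)

lemma convex_closed_epigraph: "convex (closed_epigraph D \<phi>)"
  unfolding closed_epigraph_halfspaces by (intro convex_INT) (auto simp: convex_halfspace_le)

text \<open>The support inequality at \<open>(y, \<phi> y)\<close> and the affine minorant touching
  at \<open>y\<close> add up to monotone relatedness of \<open>(z, v)\<close> with every pair of the
  graph; maximality does the rest, including \<open>z\<close> in \<open>D\<close>.\<close>

lemma closed_epigraph_supporting:
  assumes F: "maximally_monotone (subgrad D \<phi>)"
    and zt: "(z, t) \<in> closed_epigraph D \<phi>"
    and sup: "\<And>z' t'. (z', t') \<in> closed_epigraph D \<phi> \<Longrightarrow> t + v \<bullet> (z' - z) \<le> t'"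
  shows "v \<in> subgrad D \<phi> z"
proof (rule maximally_monotone_mem[OF F])
  fix y w assume w: "w \<in> subgrad D \<phi> y"
  then have "y \<in> D" by (simp add: subgrad_def)
  have "t + v \<bullet> (y - z) \<le> \<phi> y" using sup mem_closed_epigraph[OF \<open>y \<in> D\<close>] by blast
  moreover have "\<phi> y + w \<bullet> (z - y) \<le> t" using zt w by (auto simp: closed_epigraph_def)
  ultimately show "0 \<le> (z - y) \<bullet> (v - w)" by (simp add: inner_diff_left inner_diff_right inner_commute)
qed

text \<open>A functional that is constant on \<open>D\<close> can be added to every subgradient, so it stays constant
  on the projection of the closed epigraph.\<close>
lemma closed_epigraph_const:
  assumes F: "maximally_monotone (subgrad D \<phi>)"
    and c: "\<And>z. z \<in> D \<Longrightarrow> a \<bullet> z = d"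
    and zt: "(z, t) \<in> closed_epigraph D \<phi>"
  shows "a \<bullet> z = d"
proof -
  obtain x v where v: "v \<in> subgrad D \<phi> x" using maximally_monotone_nonempty[OF F] by blast
  then have x: "x \<in> D" by (simp add: subgrad_def)
  have va: "v + s *\<^sub>R a \<in> subgrad D \<phi> x" for s
    using v c x by (simp add: subgrad_def inner_add_left inner_diff_right)
  then have *: "\<phi> x + v \<bullet> (z - x) + s * (a \<bullet> (z - x)) \<le> t" for s
  proof -
    have "\<phi> x + (v + s *\<^sub>R a) \<bullet> (z - x) \<le> t"
      using zt va[of s] unfolding closed_epigraph_def by blast
    then show ?thesis by (simp add: inner_add_left)
  qed
  have "a \<bullet> (z - x) = 0"
  proof (rule ccontr)
    assume n: "a \<bullet> (z - x) \<noteq> 0"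
    \<comment> \<open>This \<open>s\<close> makes the left side of \<open>*\<close> equal to
      \<open>t + 1\<close>.\<close>
    show False using *[of "(t - \<phi> x - v \<bullet> (z - x) + 1) / (a \<bullet> (z - x))"] n by simp
  qed
  then show ?thesis using c[OF x] by (simp add: inner_diff_right)
qed

section \<open>First-order conditions and multipliers\<close>

text \<open>The right side of \<open>min\<close> has derivative \<open>s + c \<bullet> d\<close> at
  \<theta> = 0, and a negative slope would push it below \<open>q z\<close>. In the application
  \<open>s\<close> is the change of height in the closed epigraph.\<close>

lemma directional_first_order:
  fixes q :: "'a::real_inner \<Rightarrow> real"
  assumes q: "(q has_derivative (\<lambda>h. c \<bullet> h)) (at z)"
    and min: "\<And>\<theta>. 0 < \<theta> \<Longrightarrow> \<theta> < 1 \<Longrightarrow> q z \<le> \<theta> * s + q (z + \<theta> *\<^sub>R d)"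
  shows "0 \<le> s + c \<bullet> d"
proof (rule ccontr)
  assume neg: "\<not> 0 \<le> s + c \<bullet> d"
  define \<psi> where "\<psi> \<theta> = \<theta> * s + q (z + \<theta> *\<^sub>R d)" for \<theta> :: real
  have "((\<lambda>\<theta>. q (z + \<theta> *\<^sub>R d)) has_derivative (\<lambda>h. c \<bullet> (h *\<^sub>R d))) (at 0)"
    by (rule has_derivative_compose[of "\<lambda>\<theta>. z + \<theta> *\<^sub>R d" "\<lambda>h. h *\<^sub>R d"])
       (auto intro!: derivative_eq_intros simp: q)
  then have "((\<lambda>\<theta>. q (z + \<theta> *\<^sub>R d)) has_real_derivative c \<bullet> d) (at 0)"
    by (simp add: has_field_derivative_def mult.commute[of _ "c \<bullet> d"])
  then have "(\<psi> has_real_derivative (s + c \<bullet> d)) (at 0)"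
    unfolding \<psi>_def by (auto intro!: derivative_eq_intros)
  then obtain e where e: "e > 0" "\<And>h. 0 < h \<Longrightarrow> h < e \<Longrightarrow> \<psi> 0 > \<psi> (0 + h)"
    using DERIV_neg_dec_right[of \<psi> "s + c \<bullet> d" 0] neg by (metis not_le)
  define h where "h = min (e / 2) (1 / 2)"
  have "0 < h" "h < e" "h < 1" using e by (auto simp: h_def)
  with e(2)[of h] min[of h] show False by (simp add: \<psi>_def)
qed

text \<open>All products of components are nonpositive while their sum is nonnegative, so each
  vanishes. Applied with \<open>u\<close> the constraint value at the Slater point.\<close>

lemma orthant_inner_eq_0:
  fixes l u :: "real ^ 'm"
  assumes l: "l \<in> nonneg_orthant" and u: "\<And>j. u $ j < 0" and "0 \<le> l \<bullet> u"
  shows "l = 0"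
proof -
  have "l $ j * u $ j \<le> 0" for j
    using l u[of j] by (simp add: nonneg_orthant_def mult_nonneg_nonpos)
  then have "(\<Sum>j\<in>UNIV. - (l $ j * u $ j)) = 0"
    using \<open>0 \<le> l \<bullet> u\<close> by (intro antisym sum_nonneg) (auto simp: inner_vec_def sum_negf)
  then have "\<forall>j. - (l $ j * u $ j) = 0"
    using \<open>\<And>j. l $ j * u $ j \<le> 0\<close> by (subst (asm) sum_nonneg_eq_0_iff) auto
  then have "l $ j = 0" for j using u[of j] by auto
  then show "l = 0" by (simp add: vec_eq_iff)
qed

text \<open>If the functional properly separating the minimum value had no component along the value
  axis, strict feasibility would annihilate its multiplier component, and the relative interior
  condition would annihilate the rest.\<close>
lemma linearised_multiplier:
  fixes \<phi> :: "'a::euclidean_space \<Rightarrow> real" and L :: "'a \<Rightarrow> real ^ 'm"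
  assumes F: "maximally_monotone (subgrad D \<phi>)"
    and Om: "convex Om"
    and xh: "xh \<in> rel_interior Om" "xh \<in> rel_interior D"
    and L: "linear L" "\<And>j. L xh $ j < b $ j"
    and zt: "(z, t) \<in> closed_epigraph D \<phi>" "z \<in> Om" "\<And>j. L z $ j \<le> b $ j"
    and min: "\<And>z' t'. (z', t') \<in> closed_epigraph D \<phi> \<Longrightarrow> z' \<in> Om \<Longrightarrow> (\<And>j. L z' $ j \<le> b $ j)
       \<Longrightarrow> 0 \<le> t' - t + c \<bullet> (z' - z)"
  obtains v n l where "v \<in> subgrad D \<phi> z" "n \<in> normal_cone Om z" "l \<in> nonneg_orthant"
    "l \<bullet> (L z - b) = 0" "v + n + c + adjoint L l = 0"
proof -
  \<comment> \<open>The variable is split into \<open>y\<close> for the epigraph and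
    \<open>y'\<close> for \<open>Om\<close>. The entries of \<open>W\<close> perturb the coupling
    constraint, measure the mismatch of the copies, and strictly exceed the change of the linearised
    objective. The origin would encode a feasible point of smaller value.\<close>
  define W where "W = {(u, w, \<rho>). \<exists>y s y'. (y, s) \<in> closed_epigraph D \<phi> \<and> y' \<in> Om \<and>
     (\<forall>j. L y' $ j - b $ j \<le> u $ j) \<and> w = y - y' \<and> s - t + c \<bullet> (y' - z) < \<rho>}"
  have WI: "(u, y - y', \<rho>) \<in> W" if "(y, s) \<in> closed_epigraph D \<phi>" "y' \<in> Om"
    "\<And>j. L y' $ j - b $ j \<le> u $ j" "s - t + c \<bullet> (y' - z) < \<rho>" for u y y' s \<rho>
    using that by (auto simp: W_def)
  interpret L: linear L by (fact L)
  have "convex W"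
  proof (rule convexI)
    fix p p' and \<mu> \<nu> :: real assume p: "p \<in> W" "p' \<in> W" and mn: "0 \<le> \<mu>" "0 \<le> \<nu>" "\<mu> + \<nu> = 1"
    obtain u w \<rho> u' w' \<rho>' where pp: "p = (u, w, \<rho>)" "p' = (u', w', \<rho>')" by (metis prod_cases3)
    obtain y s x where 1: "(y, s) \<in> closed_epigraph D \<phi>" "x \<in> Om"
      "\<And>j. L x $ j - b $ j \<le> u $ j" "w = y - x" "s - t + c \<bullet> (x - z) < \<rho>"
      using p pp unfolding W_def by auto
    obtain y' s' x' where 2: "(y', s') \<in> closed_epigraph D \<phi>" "x' \<in> Om"
      "\<And>j. L x' $ j - b $ j \<le> u' $ j" "w' = y' - x'" "s' - t + c \<bullet> (x' - z) < \<rho>'"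
      using p pp unfolding W_def by auto
    have "\<nu> = 1 - \<mu>" using mn by simp
    have e: "(\<mu> *\<^sub>R y + \<nu> *\<^sub>R y', \<mu> * s + \<nu> * s') \<in> closed_epigraph D \<phi>"
      using convexD[OF convex_closed_epigraph 1(1) 2(1) mn] by simp
    have o: "\<mu> *\<^sub>R x + \<nu> *\<^sub>R x' \<in> Om" using convexD[OF Om 1(2) 2(2) mn] .
    have "L (\<mu> *\<^sub>R x + \<nu> *\<^sub>R x') $ j - b $ j = \<mu> * (L x $ j - b $ j) + \<nu> * (L x' $ j - b $ j)" for j
      unfolding L.add L.scale by (simp add: \<open>\<nu> = 1 - \<mu>\<close> algebra_simps)
    then have l: "L (\<mu> *\<^sub>R x + \<nu> *\<^sub>R x') $ j - b $ j \<le> (\<mu> *\<^sub>R u + \<nu> *\<^sub>R u') $ j" for j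
      using 1(3)[of j] 2(3)[of j] mn by (auto intro!: add_mono mult_left_mono)
    have "(\<mu> * s + \<nu> * s') - t + c \<bullet> ((\<mu> *\<^sub>R x + \<nu> *\<^sub>R x') - z)
       = \<mu> * (s - t + c \<bullet> (x - z)) + \<nu> * (s' - t + c \<bullet> (x' - z))"
      unfolding \<open>\<nu> = 1 - \<mu>\<close> by (simp add: inner_diff_right inner_add_right algebra_simps)
    also have "\<dots> < \<mu> * \<rho> + \<nu> * \<rho>'"
      using 1(5) 2(5) mn by (smt (verit) mult_left_mono mult_strict_left_mono)
    finally have r: "(\<mu> * s + \<nu> * s') - t + c \<bullet> ((\<mu> *\<^sub>R x + \<nu> *\<^sub>R x') - z) < \<mu> * \<rho> + \<nu> * \<rho>'" .
    have "\<mu> *\<^sub>R p + \<nu> *\<^sub>R p' = (\<mu> *\<^sub>R u + \<nu> *\<^sub>R u',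
       (\<mu> *\<^sub>R y + \<nu> *\<^sub>R y') - (\<mu> *\<^sub>R x + \<nu> *\<^sub>R x'), \<mu> * \<rho> + \<nu> * \<rho>')"
      by (simp add: pp 1(4) 2(4) algebra_simps)
    with WI[OF e o l r] show "\<mu> *\<^sub>R p + \<nu> *\<^sub>R p' \<in> W" by simp
  qed
  have W0: "0 \<notin> W"
    using min unfolding W_def zero_prod_def by fastforce
  have zW: "(0, 0, 1) \<in> W" using WI[of z t z 0 1] zt by simp
  obtain a0 where a0: "\<And>w. w \<in> W \<Longrightarrow> 0 \<le> a0 \<bullet> w" "\<exists>w\<in>W. a0 \<bullet> w \<noteq> 0"
    using proper_separation_0[OF \<open>convex W\<close> W0] zW by blast
  obtain l a k where lak: "a0 = (l, a, k)" by (metis prod_cases3)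
  have sep: "0 \<le> l \<bullet> u + a \<bullet> (y - y') + k * \<rho>" if "(y, s) \<in> closed_epigraph D \<phi>" "y' \<in> Om"
    "\<And>j. L y' $ j - b $ j \<le> u $ j" "s - t + c \<bullet> (y' - z) < \<rho>" for u y y' s \<rho>
    using a0(1)[OF WI[OF that]] by (simp add: lak add.assoc)
  have k: "0 \<le> k" using a0(1)[OF zW] by (simp add: lak)
  have l: "l \<in> nonneg_orthant"
  proof -
    have "0 \<le> l $ j" for j
    proof (rule ccontr)
      assume n: "\<not> 0 \<le> l $ j"
      have "0 \<le> l \<bullet> axis j r + k * 1" if "0 \<le> r" for r
        using sep[of z t z "axis j r" 1] zt that by (simp add: axis_def) (smt (verit) le_diff_eq)
      \<comment> \<open>The step length is chosen so that the preceding bound reads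
        \<open>0 \<le> -1\<close>.\<close>
      moreover have "0 \<le> (k + 1) / - l $ j" using n k by (intro divide_nonneg_pos) auto
      ultimately have "0 \<le> l \<bullet> axis j ((k + 1) / - l $ j) + k * 1" by blast
      with n k show False by (simp add: inner_axis)
    qed
    then show ?thesis by (simp add: nonneg_orthant_def)
  qed
  have xhm: "xh \<in> Om" "xh \<in> D" using xh rel_interior_subset by blast+
  have "k \<noteq> 0"
  proof
    assume k0: "k = 0"
    have s0: "0 \<le> l \<bullet> (L y' - b) + a \<bullet> (y - y')" if "(y, s) \<in> closed_epigraph D \<phi>" "y' \<in> Om" for y y' s
      using sep[OF that, of "L y' - b" "s - t + c \<bullet> (y' - z) + 1"] k0 by simp
    have "l = 0"
      by (rule orthant_inner_eq_0[of l "L xh - b"])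
         (use l L(2) s0[OF mem_closed_epigraph[OF xhm(2)] xhm(1)] in auto)
    then have s1: "a \<bullet> y' \<le> a \<bullet> y" if "(y, s) \<in> closed_epigraph D \<phi>" "y' \<in> Om" for y y' s
      using s0[OF that] by (simp add: inner_diff_right)
    have aD: "a \<bullet> y = a \<bullet> xh" if "y \<in> D" for y
      by (rule rel_interior_linear_minimum_const[OF xh(2) _ that]) (meson s1 mem_closed_epigraph xhm)
    have "(- a) \<bullet> y = (- a) \<bullet> xh" if "y \<in> Om" for y
      by (rule rel_interior_linear_minimum_const[OF xh(1) _ that]) (use s1[OF mem_closed_epigraph[OF xhm(2)]] in auto)
    then have aO: "a \<bullet> y = a \<bullet> xh" if "y \<in> Om" for y using that by simp
    have "a0 \<bullet> w = 0" if w: "w \<in> W" for w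
    proof -
      obtain y s y' where "fst (snd w) = y - y'" "(y, s) \<in> closed_epigraph D \<phi>" "y' \<in> Om"
        using w by (auto simp: W_def)
      then show ?thesis
        using aO closed_epigraph_const[OF F aD]
        by (cases w) (simp add: lak k0 \<open>l = 0\<close> inner_diff_right)
    qed
    with a0(2) show False by blast
  qed
  with k have k: "0 < k" by simp
  \<comment> \<open>Normalised so that the value axis carries coefficient 1.\<close>
  define l' a' where "l' = l /\<^sub>R k" and "a' = a /\<^sub>R k"
  \<comment> \<open>\<open>W\<close> only contains values strictly above the objective change, so
    the sharp bound is reached as the excess \<open>e\<close> tends to 0.\<close>
  have key: "0 \<le> l' \<bullet> (L y' - b) + a' \<bullet> (y - y') + (s - t + c \<bullet> (y' - z))"
    if "(y, s) \<in> closed_epigraph D \<phi>" "y' \<in> Om" for y y' s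
  proof (rule field_le_epsilon)
    fix e :: real assume "0 < e"
    have "0 \<le> l \<bullet> (L y' - b) + a \<bullet> (y - y') + k * (s - t + c \<bullet> (y' - z) + e)"
      using sep[OF that, of "L y' - b" "s - t + c \<bullet> (y' - z) + e"] \<open>0 < e\<close> by simp
    then have "0 \<le> (l \<bullet> (L y' - b) + a \<bullet> (y - y') + k * (s - t + c \<bullet> (y' - z) + e)) / k"
      using k by simp
    also have "\<dots> = l' \<bullet> (L y' - b) + a' \<bullet> (y - y') + (s - t + c \<bullet> (y' - z)) + e"
      using k by (simp add: l'_def a'_def add_divide_distrib divide_inverse_commute[symmetric])
    finally show "0 \<le> l' \<bullet> (L y' - b) + a' \<bullet> (y - y') + (s - t + c \<bullet> (y' - z)) + e" .
  qed
  have l': "l' \<in> nonneg_orthant" using l k by (simp add: l'_def nonneg_orthant_def)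
  have "l' \<bullet> (L z - b) \<le> 0"
    using l' zt(3) unfolding inner_vec_def
    by (intro sum_nonpos) (simp add: nonneg_orthant_def mult_nonneg_nonpos)
  with key[OF zt(1,2)] have comp: "l' \<bullet> (L z - b) = 0" by simp
  \<comment> \<open>Freezing \<open>y' = z\<close> in \<open>key\<close> isolates the subgradient;
    freezing \<open>(y, s) = (z, t)\<close> below isolates the normal vector.\<close>
  have v: "- a' \<in> subgrad D \<phi> z"
    by (rule closed_epigraph_supporting[OF F zt(1)])
       (use key[OF _ zt(2)] comp in \<open>force simp: inner_diff_right\<close>)
  have "(a' - c - adjoint L l') \<bullet> (y - z) \<le> 0" if "y \<in> Om" for y
    using key[OF zt(1) that] comp
    by (simp add: inner_diff_right inner_diff_left adjoint_works[OF L(1)] inner_commute[of "adjoint L l'"]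
       inner_commute[of l'])
  then have n: "a' - c - adjoint L l' \<in> normal_cone Om z" using zt(2) by (simp add: normal_cone_def)
  show ?thesis using that[OF v n l' comp] by simp
qed

text \<open>A minimiser of \<open>t + q z\<close> over the part of the closed epigraph above the
  feasible set exists by truncation to a compact set. It also solves the linearised problem, whose
  multipliers are available.\<close>

lemma constrained_minimiser_multiplier:
  fixes \<phi> q :: "'a::euclidean_space \<Rightarrow> real" and L :: "'a \<Rightarrow> real ^ 'm"
  assumes F: "maximally_monotone (subgrad D \<phi>)"
    and Om: "compact Om" "convex Om"
    and xh: "xh \<in> rel_interior Om" "xh \<in> rel_interior D"
    and L: "linear L" "\<And>j. L xh $ j < b $ j"
    and q: "\<And>z. (q has_derivative (\<lambda>h. c z \<bullet> h)) (at z)"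
  obtains z v n l where "v \<in> subgrad D \<phi> z" "n \<in> normal_cone Om z" "l \<in> nonneg_orthant"
    "\<And>j. L z $ j \<le> b $ j" "l \<bullet> (L z - b) = 0" "v + n + c z + adjoint L l = 0"
proof -
  interpret L: linear L by (fact L)
  have qc: "continuous_on S q" for S
    using q by (auto intro!: continuous_at_imp_continuous_on has_derivative_continuous)
  define K where "K = {z \<in> Om. \<forall>j. L z $ j \<le> b $ j}"
  have "K = Om \<inter> (\<Inter>j. {z. L z $ j \<le> b $ j})" by (auto simp: K_def)
  moreover have "closed {z. L z $ j \<le> b $ j}" for j
    using linear_continuous_on[of L UNIV] L(1)
    by (intro closed_Collect_le continuous_on_component continuous_on_const)
       (simp add: linear_conv_bounded_linear)
  ultimately have "compact K" using Om(1) by (auto intro!: compact_Int_closed closed_INT)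
  have xhm: "xh \<in> Om" "xh \<in> D" using xh rel_interior_subset by blast+
  then have xK: "xh \<in> K" using L(2) by (auto simp: K_def intro: less_imp_le)
  obtain x0 v0 where v0: "v0 \<in> subgrad D \<phi> x0" using maximally_monotone_nonempty[OF F] by blast
  have "continuous_on K (\<lambda>z. \<phi> x0 + v0 \<bullet> (z - x0))" by (intro continuous_intros)
  then obtain z1 where z1: "\<And>z. z \<in> K \<Longrightarrow> \<phi> x0 + v0 \<bullet> (z1 - x0) \<le> \<phi> x0 + v0 \<bullet> (z - x0)"
    using continuous_attains_inf[OF \<open>compact K\<close>] xK by blast
  obtain z2 where z2: "\<And>z. z \<in> K \<Longrightarrow> q z2 \<le> q z"
    using continuous_attains_inf[OF \<open>compact K\<close> _ qc] xK by blast
  \<comment> \<open>\<open>m\<close> bounds all admissible heights from below through one affine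
    minorant. Above height \<open>M\<close> the objective exceeds its value at
    \<open>(xh, \<phi> xh)\<close>, so the truncation loses no minimiser.\<close>
  define m M where "m = \<phi> x0 + v0 \<bullet> (z1 - x0)" and "M = \<phi> xh + q xh - q z2"
  define S where "S = closed_epigraph D \<phi> \<inter> K \<times> {m..M}"
  have "compact S" unfolding S_def
    by (intro closed_Int_compact closed_closed_epigraph compact_Times \<open>compact K\<close>) auto
  have low: "m \<le> t" if "(z, t) \<in> closed_epigraph D \<phi>" "z \<in> K" for z t
    using that v0 z1[of z] unfolding closed_epigraph_def m_def by fastforce
  have "(xh, \<phi> xh) \<in> S"
    using low[OF mem_closed_epigraph[OF xhm(2)] xK] mem_closed_epigraph[OF xhm(2)] xK z2[OF xK]
    by (auto simp: S_def M_def)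
  moreover have "continuous_on S (\<lambda>w. snd w + q (fst w))"
    by (intro continuous_intros continuous_on_compose2[OF qc]) auto
  ultimately obtain w where w: "w \<in> S" "\<And>w'. w' \<in> S \<Longrightarrow> snd w + q (fst w) \<le> snd w' + q (fst w')"
    using continuous_attains_inf[OF \<open>compact S\<close>] by blast
  obtain z t where zt: "w = (z, t)" by (cases w)
  have zt': "(z, t) \<in> closed_epigraph D \<phi>" "z \<in> Om" "\<And>j. L z $ j \<le> b $ j"
    using w zt by (auto simp: S_def K_def)
  have min: "t + q z \<le> t' + q z'" if "(z', t') \<in> closed_epigraph D \<phi>" "z' \<in> K" for z' t'
  proof (cases "t' \<le> M")
    case True
    then show ?thesis using w(2)[of "(z', t')"] that low[OF that] by (simp add: S_def zt)
  next
    case False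
    then show ?thesis using w(2)[OF \<open>(xh, \<phi> xh) \<in> S\<close>] z2[OF that(2)] by (simp add: M_def zt)
  qed
  have K: "convex K" unfolding K_def convex_def
    using Om(2) by (auto simp: convex_def L.add L.scale intro: convex_bound_le)
  \<comment> \<open>Moving along segments inside the closed epigraph and \<open>K\<close> replaces
    \<open>q\<close> by its derivative at \<open>z\<close>.\<close>
  have lin: "0 \<le> t' - t + c z \<bullet> (z' - z)"
    if "(z', t') \<in> closed_epigraph D \<phi>" "z' \<in> Om" "\<And>j. L z' $ j \<le> b $ j" for z' t'
  proof (rule directional_first_order[OF q])
    fix \<theta> :: real assume th: "0 < \<theta>" "\<theta> < 1"
    have "(1 - \<theta>) *\<^sub>R (z, t) + \<theta> *\<^sub>R (z', t') \<in> closed_epigraph D \<phi>"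
      using convexD[OF convex_closed_epigraph zt'(1) that(1), of "1 - \<theta>" \<theta>] th by simp
    then have e: "(z + \<theta> *\<^sub>R (z' - z), t + \<theta> * (t' - t)) \<in> closed_epigraph D \<phi>"
      by (simp add: algebra_simps)
    have "(1 - \<theta>) *\<^sub>R z + \<theta> *\<^sub>R z' \<in> K"
      using convexD[OF K, of z z' "1 - \<theta>" \<theta>] th zt' that by (simp add: K_def)
    then have "z + \<theta> *\<^sub>R (z' - z) \<in> K" by (simp add: algebra_simps)
    from min[OF e this] show "q z \<le> \<theta> * (t' - t) + q (z + \<theta> *\<^sub>R (z' - z))" by simp
  qed
  obtain v n l where "v \<in> subgrad D \<phi> z" "n \<in> normal_cone Om z" "l \<in> nonneg_orthant"
    "l \<bullet> (L z - b) = 0" "v + n + c z + adjoint L l = 0"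
    using linearised_multiplier[OF F Om(2) xh L zt' lin] by blast
  then show ?thesis using that zt'(3) by blast
qed

text \<open>The multiplier lemma is applied to a quadratic objective with gradient
  \<open>c + P (z - x0)\<close> and the inactive constraint \<open>0 \<le> 1\<close>, whose adjoint
  term vanishes.\<close>

lemma resolvent_exists:
  fixes \<phi> :: "'a::euclidean_space \<Rightarrow> real"
  assumes F: "maximally_monotone (subgrad D \<phi>)"
    and Om: "compact Om" "convex Om"
    and xh: "xh \<in> rel_interior Om" "xh \<in> rel_interior D"
    and P: "linear P" "\<And>u v. u \<bullet> P v = P u \<bullet> v"
  obtains z v n where "v \<in> subgrad D \<phi> z" "n \<in> normal_cone Om z" "v + n + c + P (z - x0) = 0"
proof -
  have bl: "bounded_linear P" using P(1) by (simp add: linear_conv_bounded_linear)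
  have q: "((\<lambda>z. c \<bullet> z + (z - x0) \<bullet> P (z - x0) / 2) has_derivative (\<lambda>h. (c + P (z - x0)) \<bullet> h)) (at z)" for z
    by (rule derivative_eq_intros bounded_linear.has_derivative[OF bl] refl | simp)+
       (simp add: fun_eq_iff inner_add_left inner_add_right P(2) inner_commute)
  obtain z v n l where *: "v \<in> subgrad D \<phi> z" "n \<in> normal_cone Om z"
    "v + n + (c + P (z - x0)) + adjoint (\<lambda>_. 0 :: real ^ 1) l = 0"
    by (rule constrained_minimiser_multiplier[OF F Om xh _ _ q, of "\<lambda>_. 0" 1]) (auto simp: linear_zero)
  have "adjoint (\<lambda>_::'a. 0 :: real ^ 1) l = 0"
    using adjoint_works[of "\<lambda>_::'a. 0 :: real ^ 1" "adjoint (\<lambda>_::'a. 0 :: real ^ 1) l" l] by (simp add: linear_zero)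
  with * that show ?thesis by (simp add: add.assoc)
qed

lemma normal_cone_monotone:
  assumes "n \<in> normal_cone S x" "m \<in> normal_cone S y"
  shows "0 \<le> (x - y) \<bullet> (n - m)"
  using assms
  by (force simp: normal_cone_def inner_diff_left inner_diff_right inner_commute split: if_splits)

text \<open>The sum is itself maximally monotone, by a resolvent argument; the two summands of a
  convergent sequence need not converge separately.\<close>
lemma subgrad_add_normal_cone_limit:
  fixes \<phi> :: "'a::euclidean_space \<Rightarrow> real"
  assumes F: "maximally_monotone (subgrad D \<phi>)"
    and Om: "compact Om" "convex Om"
    and xh: "xh \<in> rel_interior Om" "xh \<in> rel_interior D"
    and seq: "\<And>k. v k \<in> subgrad D \<phi> (x k)" "\<And>k. n k \<in> normal_cone Om (x k)"
    and lim: "x \<longlonglongrightarrow> x'" "(\<lambda>k. v k + n k) \<longlonglongrightarrow> e"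
  obtains v' n' where "v' \<in> subgrad D \<phi> x'" "n' \<in> normal_cone Om x'" "v' + n' = e"
proof -
  \<comment> \<open>A resolvent point centred at \<open>x'\<close> for the target \<open>e\<close>.
    Monotonicity against the sequence, in the limit, forces \<open>z = x'\<close>, and then
    \<open>w + m = e\<close>.\<close>
  obtain z w m where z: "w \<in> subgrad D \<phi> z" "m \<in> normal_cone Om z" "w + m + (- e) + (z - x') = 0"
    by (rule resolvent_exists[OF F Om xh, of "\<lambda>u. u" "- e" x']) (auto simp: linear_id[unfolded id_def])
  have "0 \<le> (x k - z) \<bullet> ((v k + n k) - (w + m))" for k
  proof -
    have "0 \<le> (x k - z) \<bullet> (v k - w)"
      using F seq(1) z(1) by (auto simp: maximally_monotone_def monotone_op_def)
    moreover have "0 \<le> (x k - z) \<bullet> (n k - m)" by (rule normal_cone_monotone[OF seq(2) z(2)])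
    ultimately have "0 \<le> (x k - z) \<bullet> (v k - w) + (x k - z) \<bullet> (n k - m)" by simp
    also have "\<dots> = (x k - z) \<bullet> ((v k + n k) - (w + m))" by (simp add: inner_add_right inner_diff_right)
    finally show ?thesis .
  qed
  moreover have "(\<lambda>k. (x k - z) \<bullet> ((v k + n k) - (w + m))) \<longlonglongrightarrow> (x' - z) \<bullet> (e - (w + m))"
    by (intro tendsto_intros lim)
  ultimately have "0 \<le> (x' - z) \<bullet> (e - (w + m))"
    by (intro LIMSEQ_le_const) auto
  moreover have wm: "w + m = e - (z - x')" using z(3) by (simp add: algebra_simps add_eq_0_iff)
  then have "e - (w + m) = - (x' - z)" by simp
  ultimately have "(x' - z) \<bullet> (x' - z) \<le> 0" by (simp only: inner_minus_right)
  then have "z = x'" by (metis eq_iff_diff_eq_0 inner_eq_zero_iff inner_ge_zero order_antisym)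
  with z wm that show ?thesis by simp
qed

section \<open>The mapping \<open>F_e\<close>\<close>

text \<open>The zero second component removes the aggregate from the monotonicity inequality, so a
  pair at \<open>s'\<close> remains monotonically related to the graph when moved to
  \<open>s\<close>.\<close>

lemma F_e_aggregate_indep:
  fixes f :: "'N::finite \<Rightarrow> real ^ 'n \<Rightarrow> real ^ 'n \<Rightarrow> ereal"
  assumes "maximally_monotone (\<lambda>(v, s). F_e f v s \<times> {0})"
  shows "F_e f v s = F_e f v s'"
proof -
  have "F_e f v s' \<subseteq> F_e f v s" for s s'
  proof
    fix g assume g: "g \<in> F_e f v s'"
    let ?F = "\<lambda>(v, s). F_e f v s \<times> {0 :: real ^ 'n}"
    have "(g, 0) \<in> ?F (v, s)"
    proof (rule maximally_monotone_mem[OF assms])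
      fix y w assume "w \<in> ?F y"
      then have "0 \<le> ((v, s') - y) \<bullet> ((g, 0) - w)"
        using assms g unfolding maximally_monotone_def monotone_op_def by (metis (no_types, lifting) SigmaI case_prod_conv insertI1)
      then show "0 \<le> ((v, s) - y) \<bullet> ((g, 0) - w)"
        using \<open>w \<in> ?F y\<close> by (cases y, cases w) auto
    qed
    then show "g \<in> F_e f v s" by simp
  qed
  then show ?thesis by blast
qed

text \<open>Because all slices coincide, an element of a monotone extension of one slice is
  monotonically related to the joint graph.\<close>

lemma F_e_maximally_monotone:
  fixes f :: "'N::finite \<Rightarrow> real ^ 'n \<Rightarrow> real ^ 'n \<Rightarrow> ereal"
  assumes max: "maximally_monotone (\<lambda>(v, s). F_e f v s \<times> {0})"
  shows "maximally_monotone (\<lambda>v. F_e f v s)"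
  unfolding maximally_monotone_def
proof (intro conjI allI impI)
  show "monotone_op (\<lambda>v. F_e f v s)"
    unfolding monotone_op_def
  proof (intro allI ballI)
    fix x y u w assume "u \<in> F_e f x s" "w \<in> F_e f y s"
    then show "0 \<le> (x - y) \<bullet> (u - w)"
      using max[unfolded maximally_monotone_def monotone_op_def, THEN conjunct1, rule_format, of "(u, 0)" "(x, s)" "(w, 0)" "(y, s)"]
      by simp
  qed
next
  fix G assume G: "monotone_op G \<and> (\<forall>x. F_e f x s \<subseteq> G x)"
  have "G x \<subseteq> F_e f x s" for x
  proof
    fix g assume g: "g \<in> G x"
    have "(g, 0) \<in> (\<lambda>(v, s). F_e f v s \<times> {0 :: real ^ 'n}) (x, s)"
    proof (rule maximally_monotone_mem[OF max])
      fix y w assume "w \<in> (\<lambda>(v, s). F_e f v s \<times> {0 :: real ^ 'n}) y"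
      then have "fst w \<in> F_e f (fst y) (snd y)" "snd w = 0" by (auto split: prod.splits)
      then have "fst w \<in> G (fst y)" "snd w = 0"
        using G F_e_aggregate_indep[OF max, of "fst y" "snd y" s] by auto
      then show "0 \<le> ((x, s) - y) \<bullet> ((g, 0) - w)"
        using G g by (cases y, cases w) (auto simp: monotone_op_def)
    qed
    then show "g \<in> F_e f x s" by simp
  qed
  with G show "G = (\<lambda>v. F_e f v s)" by blast
qed

text \<open>The sum is separable: block inequalities add up, and conversely a test point that
  changes only one block recovers the inequality of that block.\<close>

lemma F_e_eq_subgrad:
  assumes fin: "\<And>i u s. f i u s \<noteq> - \<infinity>"
  shows "F_e f v s = subgrad {x. \<forall>i. x $ i \<in> edom (\<lambda>u. f i u s)}
     (\<lambda>x. \<Sum>i\<in>UNIV. real_of_ereal (f i (x $ i) s)) v" (is "_ = subgrad ?D ?\<phi> v")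
proof -
  have real: "f i u s = ereal (real_of_ereal (f i u s))" if "u \<in> edom (\<lambda>u. f i u s)" for i u
    using that fin[of i u s] by (cases "f i u s") (auto simp: edom_def)
  show ?thesis
  proof (intro equalityI subsetI)
    fix g assume g: "g \<in> F_e f v s"
    have vD: "v $ i \<in> edom (\<lambda>u. f i u s)" for i
      using g by (simp add: F_e_def subdiff_def) (metis empty_iff)
    have "?\<phi> v + g \<bullet> (z - v) \<le> ?\<phi> z" if z: "z \<in> ?D" for z
    proof -
      have "real_of_ereal (f i (v $ i) s) + g $ i \<bullet> (z $ i - v $ i) \<le> real_of_ereal (f i (z $ i) s)" for i
      proof -
        have "g $ i \<in> subdiff (\<lambda>u. f i u s) (v $ i)" using g by (simp add: F_e_def)
        then have "f i (v $ i) s + ereal (g $ i \<bullet> (z $ i - v $ i)) \<le> f i (z $ i) s"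
          using vD[of i] z by (simp add: subdiff_def)
        then show ?thesis
          by (subst (asm) real[OF vD[of i]], subst (asm) real[of "z $ i" i]) (use z in simp_all)
      qed
      then have "(\<Sum>i\<in>UNIV. real_of_ereal (f i (v $ i) s) + g $ i \<bullet> (z $ i - v $ i)) \<le> ?\<phi> z"
        by (rule sum_mono)
      then show ?thesis by (simp add: sum.distrib inner_vec_def)
    qed
    with vD show "g \<in> subgrad ?D ?\<phi> v" by (simp add: subgrad_def)
  next
    fix g assume g: "g \<in> subgrad ?D ?\<phi> v"
    then have vD: "v $ i \<in> edom (\<lambda>u. f i u s)" for i by (simp add: subgrad_def)
    have "f i (v $ i) s + ereal (g $ i \<bullet> (u - v $ i)) \<le> f i u s" if u: "u \<in> edom (\<lambda>u. f i u s)" for i u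
    proof -
      define z where "z = (\<chi> j. if j = i then u else v $ j)"
      have "z \<in> ?D" using u vD by (simp add: z_def)
      then have "?\<phi> v + g \<bullet> (z - v) \<le> ?\<phi> z" using g by (simp add: subgrad_def)
      moreover have "g \<bullet> (z - v) = g $ i \<bullet> (u - v $ i)"
        by (simp add: inner_vec_def[of g] z_def if_distrib[of "\<lambda>x. x - _"] if_distrib[of "\<lambda>x. _ \<bullet> x"] sum.remove[of UNIV i])
      moreover have "?\<phi> z = ?\<phi> v - real_of_ereal (f i (v $ i) s) + real_of_ereal (f i u s)"
        by (simp add: sum.remove[of UNIV i] z_def)
      ultimately have "real_of_ereal (f i (v $ i) s) + g $ i \<bullet> (u - v $ i) \<le> real_of_ereal (f i u s)" by simp
      then show ?thesis by (subst real[OF u], subst real[OF vD]) simp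
    qed
    with vD show "g \<in> F_e f v s" by (simp add: F_e_def subdiff_def)
  qed
qed

text \<open>Strong convexity of the quadratic term makes a point satisfying the first-order inclusion
  the only minimiser, so that the choice made by \<^const>\<open>arg_min_on\<close> is determined.\<close>
lemma arg_min_on_regularised:
  fixes h :: "'a::real_inner \<Rightarrow> ereal"
  assumes v: "v \<in> subdiff h z" and n: "n \<in> normal_cone S z"
    and fin: "h z \<noteq> - \<infinity>"
    and eq: "v + n + c + P (z - x0) = 0"
    and P: "linear P" "\<And>u v. u \<bullet> P v = P u \<bullet> v" "\<And>u. u \<noteq> 0 \<Longrightarrow> 0 < u \<bullet> P u"
  shows "arg_min_on (\<lambda>u. h u + ereal (c \<bullet> u + (u - x0) \<bullet> P (u - x0) / 2)) S = z"
proof -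
  let ?q = "\<lambda>u. c \<bullet> u + (u - x0) \<bullet> P (u - x0) / 2"
  let ?o = "\<lambda>u. h u + ereal (?q u)"
  interpret P: linear P by fact
  have z: "z \<in> S" and nle: "\<And>u. u \<in> S \<Longrightarrow> n \<bullet> (u - z) \<le> 0"
    using n by (auto simp: normal_cone_def split: if_splits)
  have zd: "z \<in> edom h" and vle: "\<And>u. u \<in> edom h \<Longrightarrow> h z + ereal (v \<bullet> (u - z)) \<le> h u"
    using v by (auto simp: subdiff_def split: if_splits)
  obtain r where r: "h z = ereal r" using zd fin by (cases "h z") (auto simp: edom_def)
  \<comment> \<open>On the domain of \<open>h\<close>, the subgradient and normal cone inequalities
    together with \<open>eq\<close> cancel the terms linear in \<open>d\<close>, leaving a gain of
    at least \<open>d \<bullet> P d / 2\<close>. Off the domain the objective is infinite, whereas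
    it is finite at \<open>z\<close>.\<close>
  have less: "?o z < ?o u" if u: "u \<in> S" "u \<noteq> z" for u
  proof (cases "u \<in> edom h")
    case False
    then show ?thesis by (simp add: r edom_def top.not_eq_extremum[symmetric] top_ereal_def)
  next
    case True
    then obtain s where s: "h u = ereal s"
      using vle[OF True] by (cases "h u") (auto simp: edom_def r)
    define d where "d = u - z"
    have du: "u - x0 = (z - x0) + d" "u = z + d" by (simp_all add: d_def)
    have "(w + d) \<bullet> P (w + d) = w \<bullet> P w + 2 * (P w \<bullet> d) + d \<bullet> P d" for w
      by (simp add: P.add inner_add_left inner_add_right P(2)) (use P(2)[of w d] in \<open>simp add: inner_commute\<close>)
    then have "?q u - ?q z = (c + P (z - x0)) \<bullet> d + d \<bullet> P d / 2"
      unfolding du(1) by (simp add: du(2) inner_add_left inner_add_right add_divide_distrib)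
    moreover have "c + P (z - x0) = (v + n + c + P (z - x0)) - v - n" by simp
    then have "c + P (z - x0) = - v - n" unfolding eq by simp
    moreover have "0 < d \<bullet> P d" using P(3)[of d] u by (simp add: d_def)
    moreover have "n \<bullet> d \<le> 0" using nle u by (simp add: d_def)
    moreover have "r + v \<bullet> d \<le> s" using vle[OF True] by (simp add: r s d_def)
    ultimately have "r + ?q z < s + ?q u" by (simp add: inner_diff_left)
    then show ?thesis by (simp add: r s)
  qed
  \<comment> \<open>\<open>arg_min_on\<close> is a choice operator, so its value is determined by
    showing that the minimisers are exactly \<open>z\<close>.\<close>
  have "is_arg_min ?o (\<lambda>u. u \<in> S) u \<longleftrightarrow> u = z" for u
  proof
    assume "is_arg_min ?o (\<lambda>u. u \<in> S) u"
    then have "u \<in> S" "\<not> ?o z < ?o u" using z by (auto simp: is_arg_min_def)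
    with less show "u = z" by blast
  next
    assume "u = z"
    moreover have "\<not> ?o y < ?o z" if "y \<in> S" for y
      using less[OF that] by (cases "y = z") (auto dest: less_asym)
    ultimately show "is_arg_min ?o (\<lambda>u. u \<in> S) u" using z unfolding is_arg_min_def by blast
  qed
  then have "is_arg_min ?o (\<lambda>u. u \<in> S) = (\<lambda>u. u = z)" by (intro ext)
  then show ?thesis unfolding arg_min_on_def arg_min_def by simp
qed

section \<open>Preconditioned proximal point iteration\<close>

text \<open>The constant is the minimum of the quadratic form over the compact unit sphere;
  homogeneity extends the bound.\<close>

lemma positive_definite_lower_bound:
  fixes \<Phi> :: "'a::euclidean_space \<Rightarrow> 'a"
  assumes lin: "linear \<Phi>" and pos: "\<And>u. u \<noteq> 0 \<Longrightarrow> 0 < u \<bullet> \<Phi> u"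
  obtains c where "0 < c" "\<And>u. c * (norm u)\<^sup>2 \<le> u \<bullet> \<Phi> u"
proof -
  interpret linear \<Phi> by fact
  have cont: "continuous_on (sphere 0 1) (\<lambda>u. u \<bullet> \<Phi> u)"
    by (intro continuous_intros linear_continuous_on) (use lin in \<open>simp add: linear_conv_bounded_linear\<close>)
  obtain b :: 'a where "b \<in> Basis" using nonempty_Basis by blast
  then have "sphere (0::'a) 1 \<noteq> {}" by (auto simp: norm_Basis intro!: exI[of _ b])
  then obtain m where m: "m \<in> sphere 0 1" "\<And>u. u \<in> sphere 0 1 \<Longrightarrow> m \<bullet> \<Phi> m \<le> u \<bullet> \<Phi> u"
    using continuous_attains_inf[OF compact_sphere _ cont] by blast
  show ?thesis
  proof
    show "0 < m \<bullet> \<Phi> m" using m(1) by (intro pos) auto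
    fix u :: 'a
    show "m \<bullet> \<Phi> m * (norm u)\<^sup>2 \<le> u \<bullet> \<Phi> u"
    proof (cases "u = 0")
      case False
      have "m \<bullet> \<Phi> m \<le> (u /\<^sub>R norm u) \<bullet> \<Phi> (u /\<^sub>R norm u)" using False by (intro m(2)) simp
      also have "\<dots> = (u \<bullet> \<Phi> u) / (norm u)\<^sup>2" by (simp add: scale power2_eq_square divide_inverse)
      finally show ?thesis using False by (simp add: field_simps)
    qed simp
  qed
qed

text \<open>\<open>Z\<close> stands for the zeros of a monotone operator, whose value at \<open>w (Suc k)\<close> contains
  \<open>- \<Phi> (w (Suc k) - w k)\<close>; monotonicity is only used through \<open>fejer\<close>.\<close>
lemma preconditioned_proximal_point:
  fixes \<Phi> :: "'a::euclidean_space \<Rightarrow> 'a" and w :: "nat \<Rightarrow> 'a"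
  assumes lin: "linear \<Phi>" and sym: "\<And>u v. u \<bullet> \<Phi> v = \<Phi> u \<bullet> v"
    and pos: "\<And>u. u \<noteq> 0 \<Longrightarrow> 0 < u \<bullet> \<Phi> u"
    and fejer: "\<And>z k. z \<in> Z \<Longrightarrow> (w (Suc k) - z) \<bullet> \<Phi> (w (Suc k) - w k) \<le> 0"
    and Z: "Z \<noteq> {}"
    and closed: "\<And>r z. strict_mono r \<Longrightarrow> (\<lambda>k. w (r k)) \<longlonglongrightarrow> z \<Longrightarrow> (\<lambda>k. w (Suc (r k))) \<longlonglongrightarrow> z \<Longrightarrow> z \<in> Z"
  shows "\<exists>z\<in>Z. w \<longlonglongrightarrow> z"
proof -
  interpret linear \<Phi> by fact
  define V where "V u = u \<bullet> \<Phi> u" for u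
  obtain c where c: "0 < c" "\<And>u. c * (norm u)\<^sup>2 \<le> V u"
    using positive_definite_lower_bound[OF lin pos] unfolding V_def by blast
  have V0: "0 \<le> V u" for u using pos[of u] by (cases "u = 0") (auto simp: V_def)
  have contV: "isCont V u" for u unfolding V_def
    by (intro continuous_intros linear_continuous_at) (use lin in \<open>simp add: linear_conv_bounded_linear\<close>)
  have V_imp_0: "u \<longlonglongrightarrow> 0" if "(\<lambda>k. V (u k)) \<longlonglongrightarrow> 0" for u :: "nat \<Rightarrow> 'a"
  proof -
    have "(\<lambda>k. V (u k) / c) \<longlonglongrightarrow> 0" using tendsto_divide[OF that tendsto_const, of c] c by simp
    then have "(\<lambda>k. (norm (u k))\<^sup>2) \<longlonglongrightarrow> 0"
      by (rule Lim_null_comparison[rotated]) (use c in \<open>auto simp: field_simps\<close>)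
    then have "(\<lambda>k. norm (u k)) \<longlonglongrightarrow> 0" using tendsto_real_sqrt[of "\<lambda>k. (norm (u k))\<^sup>2" 0] by simp
    then show ?thesis by (simp add: tendsto_norm_zero_iff)
  qed
  \<comment> \<open>Expanding \<open>V (e - d)\<close> leaves the cross term
    \<open>e \<bullet> \<Phi> d\<close>, whose sign is given by \<open>fejer\<close>.\<close>
  have desc: "V (w (Suc k) - z) + V (w (Suc k) - w k) \<le> V (w k - z)" if "z \<in> Z" for z k
  proof -
    define e d where "e = w (Suc k) - z" and "d = w (Suc k) - w k"
    have "V (e - d) = V e - 2 * (e \<bullet> \<Phi> d) + V d"
      using sym[of d e] by (simp add: V_def diff inner_diff_left inner_diff_right inner_commute)
    moreover have "e \<bullet> \<Phi> d \<le> 0" using fejer[OF that] by (simp add: e_def d_def)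
    moreover have "w k - z = e - d" by (simp add: e_def d_def)
    ultimately show ?thesis by (simp add: e_def[symmetric] d_def[symmetric])
  qed
  have dec: "decseq (\<lambda>k. V (w k - z))" if "z \<in> Z" for z
  proof (rule decseq_SucI)
    fix k show "V (w (Suc k) - z) \<le> V (w k - z)"
      using desc[OF that, of k] V0[of "w (Suc k) - w k"] by simp
  qed
  obtain z0 where z0: "z0 \<in> Z" using Z by blast
  obtain L where L: "(\<lambda>k. V (w k - z0)) \<longlonglongrightarrow> L"
    using decseq_convergent[OF dec[OF z0], of 0] V0 by blast
  have "(\<lambda>k. V (w k - z0) - V (w (Suc k) - z0)) \<longlonglongrightarrow> L - L"
    by (intro tendsto_diff L LIMSEQ_Suc)
  then have *: "(\<lambda>k. V (w k - z0) - V (w (Suc k) - z0)) \<longlonglongrightarrow> 0" by simp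
  \<comment> \<open>The squared increments are dominated by differences of consecutive terms of a
    convergent sequence.\<close>
  have "(\<lambda>k. V (w (Suc k) - w k)) \<longlonglongrightarrow> 0"
  proof (rule Lim_null_comparison[OF _ *], intro always_eventually allI)
    fix k
    show "norm (V (w (Suc k) - w k)) \<le> V (w k - z0) - V (w (Suc k) - z0)"
      using desc[OF z0, of k] V0[of "w (Suc k) - w k"] by simp
  qed
  then have step: "(\<lambda>k. w (Suc k) - w k) \<longlonglongrightarrow> 0" by (rule V_imp_0)
  have "bounded (range w)"
  proof -
    have "norm (w k) \<le> sqrt (V (w 0 - z0) / c) + norm z0" for k
    proof -
      have "c * (norm (w k - z0))\<^sup>2 \<le> V (w 0 - z0)"
        using c(2)[of "w k - z0"] decseqD[OF dec[OF z0], of 0 k] by simp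
      then have "norm (w k - z0) \<le> sqrt (V (w 0 - z0) / c)"
        using c(1) by (intro real_le_rsqrt) (simp add: field_simps)
      then show ?thesis using norm_triangle_sub[of "w k" z0] by simp
    qed
    then show ?thesis by (auto simp: bounded_iff)
  qed
  then obtain z r where r: "strict_mono r" "(w \<circ> r) \<longlonglongrightarrow> z"
    using bounded_imp_convergent_subsequence[of w] by blast
  have "(\<lambda>k. w (Suc (r k)) - w (r k)) \<longlonglongrightarrow> 0"
    using LIMSEQ_subseq_LIMSEQ[OF step r(1)] by (simp add: o_def)
  from tendsto_add[OF this r(2)] have "(\<lambda>k. w (Suc (r k))) \<longlonglongrightarrow> z" by (simp add: o_def)
  with closed[OF r(1)] r(2) have z: "z \<in> Z" by (simp add: o_def)
  \<comment> \<open>The cluster point \<open>z\<close> is itself in \<open>Z\<close>, so its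
    distances converge too; the subsequence identifies the limit as 0.\<close>
  obtain l where l: "(\<lambda>k. V (w k - z)) \<longlonglongrightarrow> l"
    using decseq_convergent[OF dec[OF z], of 0] V0 by blast
  have "(\<lambda>k. V ((w \<circ> r) k - z)) \<longlonglongrightarrow> V (z - z)"
    by (intro isCont_tendsto_compose[OF contV] tendsto_intros r(2))
  moreover have "(\<lambda>k. V ((w \<circ> r) k - z)) \<longlonglongrightarrow> l"
    using LIMSEQ_subseq_LIMSEQ[OF l r(1)] by (simp add: o_def)
  ultimately have "l = 0" using LIMSEQ_unique by (fastforce simp: V_def)
  with l have "(\<lambda>k. w k - z) \<longlonglongrightarrow> 0" by (intro V_imp_0) simp
  with z show ?thesis using LIM_zero_cancel by blast
qed

section \<open>Product sets and normal cones\<close>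

lemma compact_vec_prod:
  fixes S :: "'i::finite \<Rightarrow> 'a::euclidean_space set"
  assumes "\<And>i. compact (S i)"
  shows "compact {x. \<forall>i. x $ i \<in> S i}"
proof -
  have "\<forall>i. \<exists>B. \<forall>u\<in>S i. norm u \<le> B" using compact_imp_bounded[OF assms] by (simp add: bounded_iff)
  then obtain B where B: "\<And>i u. u \<in> S i \<Longrightarrow> norm u \<le> B i" by metis
  have "norm x \<le> sum B UNIV" if "\<forall>i. x $ i \<in> S i" for x
  proof -
    have "norm x \<le> (\<Sum>i\<in>UNIV. norm (x $ i))" unfolding norm_vec_def by (rule L2_set_le_sum) simp
    also have "\<dots> \<le> sum B UNIV" using that B by (intro sum_mono) blast
    finally show ?thesis .
  qed
  then have "bounded {x. \<forall>i. x $ i \<in> S i}" by (auto simp: bounded_iff)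
  moreover have "{x. \<forall>i. x $ i \<in> S i} = (\<Inter>i. (\<lambda>x. x $ i) -` S i)" by auto
  moreover have "closed ((\<lambda>x. x $ i) -` S i)" for i
    by (intro closed_vimage compact_imp_closed assms continuous_intros)
  ultimately show ?thesis by (simp add: compact_eq_bounded_closed closed_INT)
qed

lemma convex_vec_prod:
  assumes "\<And>i. convex (S i)" shows "convex {x. \<forall>i. x $ i \<in> S i}"
  using assms by (simp add: convex_def)

text \<open>A test point differing from \<open>x\<close> only in block \<open>i\<close> leaves a
  single term of the inner product.\<close>

lemma normal_cone_vec_prod_component:
  fixes S :: "'i::finite \<Rightarrow> 'a::euclidean_space set"
  assumes n: "n \<in> normal_cone {x. \<forall>i. x $ i \<in> S i} x"
  shows "n $ i \<in> normal_cone (S i) (x $ i)"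
proof -
  have x: "\<forall>i. x $ i \<in> S i" and le: "\<And>z. \<forall>i. z $ i \<in> S i \<Longrightarrow> n \<bullet> (z - x) \<le> 0"
    using n by (auto simp: normal_cone_def split: if_splits)
  have "n $ i \<bullet> (u - x $ i) \<le> 0" if u: "u \<in> S i" for u
  proof -
    define z where "z = (\<chi> j. if j = i then u else x $ j)"
    have "n \<bullet> (z - x) = n $ i \<bullet> (u - x $ i)"
      by (simp add: inner_vec_def[of n] z_def if_distrib[of "\<lambda>x. x - _"] if_distrib[of "\<lambda>x. _ \<bullet> x"] sum.remove[of UNIV i])
    moreover have "\<forall>i. z $ i \<in> S i" using x u by (simp add: z_def)
    ultimately show ?thesis using le by metis
  qed
  with x show ?thesis by (simp add: normal_cone_def)
qed

lemma normal_cone_limit: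
  assumes S: "closed S" and r: "\<And>k. r k \<in> normal_cone S (l k)"
    and lim: "r \<longlonglongrightarrow> r'" "l \<longlonglongrightarrow> l'"
  shows "r' \<in> normal_cone S l'"
proof -
  have l: "l k \<in> S" and le: "\<And>z. z \<in> S \<Longrightarrow> r k \<bullet> (z - l k) \<le> 0" for k
    using r[of k] by (auto simp: normal_cone_def split: if_splits)
  have "l' \<in> S" using closed_sequentially[OF S] l lim by blast
  moreover have "r' \<bullet> (z - l') \<le> 0" if "z \<in> S" for z
  proof (rule LIMSEQ_le_const2)
    show "(\<lambda>k. r k \<bullet> (z - l k)) \<longlonglongrightarrow> r' \<bullet> (z - l')" by (intro tendsto_intros lim)
  qed (use le that in auto)
  ultimately show ?thesis by (simp add: normal_cone_def)
qed

lemma nonneg_orthant_closed_convex: "closed (nonneg_orthant :: (real ^ 'm) set)" "convex (nonneg_orthant :: (real ^ 'm) set)"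
proof -
  have "nonneg_orthant = (\<Inter>j. {l :: real ^ 'm. 0 \<le> l $ j})" by (auto simp: nonneg_orthant_def)
  moreover have "closed (\<Inter>j. {l :: real ^ 'm. 0 \<le> l $ j})"
    by (intro closed_INT ballI closed_Collect_le continuous_intros)
  ultimately show "closed (nonneg_orthant :: (real ^ 'm) set)" by simp
  show "convex (nonneg_orthant :: (real ^ 'm) set)" by (simp add: convex_def nonneg_orthant_def)
qed

text \<open>Complementary slackness: adding a unit vector to \<open>l\<close> tests the signs of
  \<open>u\<close>, and the points 0 and \<open>2 *\<^sub>R l\<close> give both inequalities for
  \<open>l \<bullet> u\<close>.\<close>

lemma normal_cone_nonneg_orthant:
  fixes l u :: "real ^ 'm"
  shows "u \<in> normal_cone nonneg_orthant l \<longleftrightarrow> l \<in> nonneg_orthant \<and> (\<forall>j. u $ j \<le> 0) \<and> l \<bullet> u = 0"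
proof
  assume u: "u \<in> normal_cone nonneg_orthant l"
  then have l: "l \<in> nonneg_orthant" and le: "\<And>z. z \<in> nonneg_orthant \<Longrightarrow> u \<bullet> (z - l) \<le> 0"
    by (auto simp: normal_cone_def split: if_splits)
  have "u $ j \<le> 0" for j
  proof -
    have "l + axis j 1 \<in> nonneg_orthant" using l by (simp add: nonneg_orthant_def axis_def)
    from le[OF this] show ?thesis by (simp add: inner_axis)
  qed
  moreover have "l \<bullet> u = 0"
    using le[of 0] le[of "2 *\<^sub>R l"] l by (simp add: nonneg_orthant_def inner_diff_right inner_commute)
  ultimately show "l \<in> nonneg_orthant \<and> (\<forall>j. u $ j \<le> 0) \<and> l \<bullet> u = 0" using l by blast
next
  assume *: "l \<in> nonneg_orthant \<and> (\<forall>j. u $ j \<le> 0) \<and> l \<bullet> u = 0"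
  have "u \<bullet> z \<le> 0" if "z \<in> nonneg_orthant" for z
    using that * unfolding inner_vec_def by (intro sum_nonpos) (simp add: nonneg_orthant_def mult_nonpos_nonneg)
  with * show "u \<in> normal_cone nonneg_orthant l"
    by (simp add: normal_cone_def inner_diff_right inner_commute)
qed

text \<open>Turns the projected dual update into an inclusion at the new iterate.\<close>

lemma closest_point_normal_cone:
  fixes S :: "'a::euclidean_space set"
  assumes "closed S" "convex S" "S \<noteq> {}"
  shows "a - closest_point S a \<in> normal_cone S (closest_point S a)"
  using closest_point_dot[OF assms(2,1)] closest_point_in_set[OF assms(1,3)]
  by (simp add: normal_cone_def)

section \<open>The preconditioner of the algorithm\<close>

definition coupling :: "('N::finite \<Rightarrow> real ^ 'n ^ 'm) \<Rightarrow> (real ^ 'n) ^ 'N \<Rightarrow> real ^ 'm" where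
  "coupling A x = (\<Sum>i\<in>UNIV. A i *v (x $ i))"

lemma linear_coupling: "linear (coupling A)"
  unfolding coupling_def
  by (rule linearI) (simp_all add: matrix_vector_right_distrib sum.distrib scaleR_sum_right matrix_vector_mult_scaleR)

lemma coupling_inner: "coupling A x \<bullet> l = (\<Sum>i\<in>UNIV. x $ i \<bullet> (transpose (A i) *v l))"
  by (simp add: coupling_def inner_sum_left dot_lmul_matrix inner_commute[of "_ $ _"] inner_commute[of "_ *v _"])

lemma adjoint_coupling: "adjoint (coupling A) l = (\<chi> i. transpose (A i) *v l)"
proof -
  have "adjoint (coupling A) = (\<lambda>l. \<chi> i. transpose (A i) *v l)"
    by (rule adjoint_unique) (simp add: coupling_inner inner_vec_def[of _ "vec_lambda _"])
  then show ?thesis by simp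
qed

text \<open>At \<open>z - x\<close> this is the gradient of the proximal term of one agent, with
  \<open>g\<close> its step size.\<close>

definition precond_block :: "real ^ 'n ^ 'm \<Rightarrow> real \<Rightarrow> real ^ 'n \<Rightarrow> real ^ 'n" where
  "precond_block A g u = (u + transpose A *v (A *v u)) /\<^sub>R g"

lemma linear_precond_block: "linear (precond_block A g)"
  unfolding precond_block_def
  by (rule linearI)
     (simp_all del: transpose_matrix_vector add: matrix_vector_right_distrib matrix_vector_mult_scaleR scaleR_add_right mult.commute)

lemma inner_precond_block:
  "u \<bullet> precond_block A g v = (u \<bullet> v + (A *v u) \<bullet> (A *v v)) / g"
proof -
  have "u \<bullet> (transpose A *v w) = (A *v u) \<bullet> w" for w
    by (simp add: dot_lmul_matrix inner_commute[of u] inner_commute[of w])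
  then show ?thesis by (simp add: precond_block_def inner_add_right divide_inverse mult.commute)
qed

lemma wnorm_sq_precond_block:
  "1 / (2 * g) * wnorm_sq (mat 1 + transpose A ** A) u = u \<bullet> precond_block A g u / 2"
proof -
  have "(mat 1 + transpose A ** A) *v u = u + transpose A *v (A *v u)"
    by (simp only: matrix_vector_mult_add_rdistrib matrix_vector_mul_lid matrix_vector_mul_assoc)
  then show ?thesis by (simp add: wnorm_sq_def precond_block_def inverse_eq_divide)
qed

text \<open>The rows are read off the iteration by writing each update as an inclusion evaluated at the new
  iterate. The dual row is multiplied by \<open>N\<close>, without which the operator would not be symmetric.\<close>
definition precond ::
  "('N::finite \<Rightarrow> real ^ 'n ^ 'm) \<Rightarrow> ('N \<Rightarrow> real) \<Rightarrow> real \<Rightarrow> real \<Rightarrow> real \<Rightarrow>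
    ((real ^ 'n) ^ 'N) \<times> (real ^ 'n) \<times> (real ^ 'n) \<times> (real ^ 'm) \<Rightarrow>
    ((real ^ 'n) ^ 'N) \<times> (real ^ 'n) \<times> (real ^ 'n) \<times> (real ^ 'm)" where
  "precond A \<gamma> \<alpha> \<beta> \<delta> = (\<lambda>(x, \<sigma>, \<mu>, l).
     ((\<chi> i. precond_block (A i) (\<gamma> i) (x $ i) - transpose (A i) *v l + (1 / real CARD('N)) *\<^sub>R \<mu>),
      \<sigma> /\<^sub>R \<alpha>, (1 / \<beta> - \<alpha>) *\<^sub>R \<mu> + avg x, (real CARD('N) / \<delta>) *\<^sub>R l - coupling A x))"

lemma linear_avg: "linear avg"
  unfolding avg_def by (rule linearI) (simp_all add: sum.distrib scaleR_add_right scaleR_sum_right mult.commute)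

lemma linear_precond: "linear (precond A \<gamma> \<alpha> \<beta> \<delta>)"
proof -
  note lin = linear_add[OF linear_avg] linear_scale[OF linear_avg]
    linear_add[OF linear_coupling] linear_scale[OF linear_coupling]
    linear_add[OF linear_precond_block] linear_scale[OF linear_precond_block]
  show ?thesis
    by (rule linearI)
       (auto simp del: transpose_matrix_vector simp: precond_def lin vec_eq_iff matrix_vector_right_distrib matrix_vector_mult_scaleR algebra_simps)
qed

text \<open>The form is written out so that its symmetry is visible and squares can be
  completed.\<close>

lemma inner_precond:
  fixes A :: "'N::finite \<Rightarrow> real ^ 'n ^ 'm"
  shows "(x, \<sigma>, \<mu>, l) \<bullet> precond A \<gamma> \<alpha> \<beta> \<delta> (x', \<sigma>', \<mu>', l') =
    (\<Sum>i\<in>UNIV. (x $ i \<bullet> x' $ i + (A i *v (x $ i)) \<bullet> (A i *v (x' $ i))) / \<gamma> i)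
    - coupling A x \<bullet> l' - coupling A x' \<bullet> l + avg x \<bullet> \<mu>' + avg x' \<bullet> \<mu>
    + (\<sigma> \<bullet> \<sigma>') / \<alpha> + (1 / \<beta> - \<alpha>) * (\<mu> \<bullet> \<mu>') + real CARD('N) / \<delta> * (l \<bullet> l')"
proof -
  have "x \<bullet> (\<chi> i. precond_block (A i) (\<gamma> i) (x' $ i) - transpose (A i) *v l' + (1 / real CARD('N)) *\<^sub>R \<mu>')
    = (\<Sum>i\<in>UNIV. (x $ i \<bullet> x' $ i + (A i *v (x $ i)) \<bullet> (A i *v (x' $ i))) / \<gamma> i)
      - coupling A x \<bullet> l' + avg x \<bullet> \<mu>'"
    unfolding coupling_inner
    by (simp add: inner_vec_def[of x] inner_add_right inner_diff_right inner_precond_block sum.distrib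
        sum_subtractf avg_def inner_sum_left sum_divide_distrib)
  then show ?thesis
    by (simp add: precond_def inner_add_right inner_diff_right inner_commute divide_inverse mult.commute)
qed

lemma precond_symmetric: "u \<bullet> precond A \<gamma> \<alpha> \<beta> \<delta> v = precond A \<gamma> \<alpha> \<beta> \<delta> u \<bullet> v"
  by (subst (2) inner_commute, cases u, cases v) (simp add: inner_precond inner_commute)

text \<open>The cross terms with \<mu> and \<open>l\<close> are distributed over the agents and
  absorbed into squares weighted by \<open>1 / \<gamma> i\<close>. The remaining coefficients of the
  squared norms of \<mu> and \<open>l\<close> are positive exactly by the bounds on \<beta> and
  \<delta>.\<close>

lemma precond_positive:
  fixes A :: "'N::finite \<Rightarrow> real ^ 'n ^ 'm"
  assumes \<gamma>: "\<And>i. \<gamma> i > 0" and ghat: "ghat = (1 / real CARD('N)) * (\<Sum>i\<in>UNIV. \<gamma> i)"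
    and \<alpha>: "\<alpha> > 0" and \<delta>: "0 < \<delta>" "\<delta> < 1 / ghat"
    and \<beta>: "0 < \<beta>" "\<beta> < 1 / (\<alpha> + ghat / real CARD('N))"
    and "w \<noteq> 0"
  shows "0 < w \<bullet> precond A \<gamma> \<alpha> \<beta> \<delta> w"
proof -
  let ?N = "real CARD('N)"
  obtain x \<sigma> \<mu> l where w: "w = (x, \<sigma>, \<mu>, l)" by (metis prod_cases4)
  have N: "0 < ?N" by simp
  have ghat0: "0 < ghat" unfolding ghat using \<gamma> by (intro mult_pos_pos sum_pos) auto
  have sg: "(\<Sum>i\<in>UNIV. \<gamma> i) = ?N * ghat" by (simp add: ghat)
  have k\<mu>: "0 < 1 / \<beta> - \<alpha> - ghat / ?N"
    using \<beta> \<alpha> ghat0 N by (simp add: less_divide_eq divide_less_eq add_pos_pos mult.commute) (simp add: field_simps)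
  have kl: "0 < ?N / \<delta> - ?N * ghat"
    using \<delta> ghat0 N by (simp add: field_simps)
  define Q where "Q = (\<Sum>i\<in>UNIV. ((norm (x $ i + (\<gamma> i / ?N) *\<^sub>R \<mu>))\<^sup>2 + (norm (A i *v (x $ i) - \<gamma> i *\<^sub>R l))\<^sup>2) / \<gamma> i)"
  have block: "((norm (x $ i + (\<gamma> i / ?N) *\<^sub>R \<mu>))\<^sup>2 + (norm (A i *v (x $ i) - \<gamma> i *\<^sub>R l))\<^sup>2) / \<gamma> i
     = (x $ i \<bullet> x $ i + (A i *v (x $ i)) \<bullet> (A i *v (x $ i))) / \<gamma> i
       + 2 * (x $ i \<bullet> \<mu> / ?N) + \<gamma> i * ((\<mu> \<bullet> \<mu>) / ?N\<^sup>2) - 2 * ((A i *v (x $ i)) \<bullet> l) + \<gamma> i * (l \<bullet> l)" for i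
    using \<gamma>[of i] N unfolding power2_norm_eq_inner
    by (simp add: inner_add_left inner_add_right inner_diff_left inner_diff_right inner_commute)
       (simp add: field_simps power2_eq_square)
  have Q: "Q = (\<Sum>i\<in>UNIV. (x $ i \<bullet> x $ i + (A i *v (x $ i)) \<bullet> (A i *v (x $ i))) / \<gamma> i)
     + 2 * (avg x \<bullet> \<mu>) + ?N * ghat * ((\<mu> \<bullet> \<mu>) / ?N\<^sup>2) - 2 * (coupling A x \<bullet> l) + ?N * ghat * (l \<bullet> l)"
    unfolding Q_def block sg[symmetric]
    by (simp add: sum.distrib sum_subtractf sum_distrib_left sum_distrib_right avg_def coupling_def inner_sum_left
        sum_divide_distrib)
  have V: "w \<bullet> precond A \<gamma> \<alpha> \<beta> \<delta> w = Q + (\<sigma> \<bullet> \<sigma>) / \<alpha>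
     + (1 / \<beta> - \<alpha> - ghat / ?N) * (\<mu> \<bullet> \<mu>) + (?N / \<delta> - ?N * ghat) * (l \<bullet> l)"
    unfolding w inner_precond Q using N by (simp add: power2_eq_square algebra_simps)
  have Q0: "0 \<le> Q" unfolding Q_def using \<gamma> by (intro sum_nonneg divide_nonneg_pos) auto
  show ?thesis
  proof (cases "\<sigma> = 0 \<and> \<mu> = 0 \<and> l = 0")
    case False
    have nn: "0 \<le> (\<sigma> \<bullet> \<sigma>) / \<alpha>" "0 \<le> (1 / \<beta> - \<alpha> - ghat / ?N) * (\<mu> \<bullet> \<mu>)"
      "0 \<le> (?N / \<delta> - ?N * ghat) * (l \<bullet> l)" using \<alpha> k\<mu> kl by simp_all
    consider "\<sigma> \<noteq> 0" | "\<mu> \<noteq> 0" | "l \<noteq> 0" using False by blast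
    then show ?thesis
    proof cases
      case 1
      then have "0 < (\<sigma> \<bullet> \<sigma>) / \<alpha>" using \<alpha> by simp
      with nn Q0 show ?thesis unfolding V by linarith
    next
      case 2
      then have "0 < (1 / \<beta> - \<alpha> - ghat / ?N) * (\<mu> \<bullet> \<mu>)" using k\<mu> by (intro mult_pos_pos) auto
      with nn Q0 show ?thesis unfolding V by linarith
    next
      case 3
      then have "0 < (?N / \<delta> - ?N * ghat) * (l \<bullet> l)" using kl by (intro mult_pos_pos) auto
      with nn Q0 show ?thesis unfolding V by linarith
    qed
  next
    case True
    then have "x \<noteq> 0" using \<open>w \<noteq> 0\<close> w by (auto simp: zero_prod_def)
    then obtain i where i: "x $ i \<noteq> 0" by (auto simp: vec_eq_iff)
    \<comment> \<open>With \<sigma>, \<mu> and \<open>l\<close> zero, a nonzero block of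
      \<open>x\<close> still contributes a positive summand to \<open>Q\<close>.\<close>
    have "0 < Q" unfolding Q_def
    proof (rule sum_pos2[of _ i])
      show "0 < ((norm (x $ i + (\<gamma> i / ?N) *\<^sub>R \<mu>))\<^sup>2 + (norm (A i *v (x $ i) - \<gamma> i *\<^sub>R l))\<^sup>2) / \<gamma> i"
        using i True \<gamma>[of i] by (simp add: add_pos_nonneg)
    qed (use \<gamma> in \<open>auto intro!: divide_nonneg_pos\<close>)
    with True show ?thesis unfolding V by simp
  qed
qed

section \<open>Zeros of the operator and convergence\<close>

text \<open>Zeros of the operator \<open>T\<close> with \<open>y\<close> eliminated; \<open>l\<close> is the dual component divided by \<open>N\<close>.\<close>
definition kkt_points ::
  "((real ^ 'n) ^ 'N::finite \<Rightarrow> ((real ^ 'n) ^ 'N) set) \<Rightarrow> ((real ^ 'n) ^ 'N) set \<Rightarrow>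
    ('N \<Rightarrow> real ^ 'n ^ 'm) \<Rightarrow> real ^ 'm \<Rightarrow>
    (((real ^ 'n) ^ 'N) \<times> (real ^ 'n) \<times> (real ^ 'n) \<times> (real ^ 'm)) set" where
  "kkt_points F Om A c = {(x, \<sigma>, \<mu>, l). \<mu> = 0 \<and> \<sigma> = avg x \<and>
     coupling A x - c \<in> normal_cone nonneg_orthant l \<and>
     (\<exists>v\<in>F x. \<exists>n\<in>normal_cone Om x. v + n + adjoint (coupling A) l = 0)}"

lemma normal_cone_scaleR: "0 \<le> t \<Longrightarrow> r \<in> normal_cone S x \<Longrightarrow> t *\<^sub>R r \<in> normal_cone S x"
  by (auto simp: normal_cone_def mult_nonneg_nonpos split: if_splits)

text \<open>The right factor is the negative of an element of the reduced operator at
  \<open>(x, \<sigma>, \<mu>, l)\<close>. After subtracting the stationarity equation at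
  \<open>z\<close>, the skew couplings through \<open>avg\<close> and \<open>coupling A\<close>
  cancel, and three monotone pairings remain.\<close>

lemma kkt_fejer:
  fixes A :: "'N::finite \<Rightarrow> real ^ 'n ^ 'm"
  assumes F: "monotone_op F" and z: "z \<in> kkt_points F Om A c"
    and v: "v \<in> F x" and n: "n \<in> normal_cone Om x" and r: "r \<in> normal_cone nonneg_orthant l"
  shows "((x, \<sigma>, \<mu>, l) - z) \<bullet> (- (v + n + adjoint (coupling A) l - avg_transp \<mu>), - \<mu>, - (avg x - \<sigma>),
    - (r - (coupling A x - c))) \<le> 0"
proof -
  obtain xs ls vs ns where z': "z = (xs, avg xs, 0, ls)"
    and rs: "coupling A xs - c \<in> normal_cone nonneg_orthant ls"
    and vs: "vs \<in> F xs" and ns: "ns \<in> normal_cone Om xs" and eq: "vs + ns + adjoint (coupling A) ls = 0"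
    using z by (auto simp: kkt_points_def)
  have adj: "u \<bullet> adjoint (coupling A) m = coupling A u \<bullet> m" for u m
    by (rule adjoint_works[OF linear_coupling])
  have avt: "u \<bullet> avg_transp m = avg u \<bullet> m" for u :: "(real ^ 'n) ^ 'N" and m
    by (simp add: avg_transp_adjoint)
  have "(x - xs) \<bullet> (vs + ns + adjoint (coupling A) ls) = 0" by (simp add: eq)
  then have e: "(x - xs) \<bullet> vs + (x - xs) \<bullet> ns + (coupling A x - coupling A xs) \<bullet> ls = 0"
    by (simp add: inner_add_right adj linear_diff[OF linear_coupling])
  have "0 \<le> (x - xs) \<bullet> (v - vs)" using F v vs by (simp add: monotone_op_def)
  moreover have "0 \<le> (x - xs) \<bullet> (n - ns)" by (rule normal_cone_monotone[OF n ns])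
  moreover have "0 \<le> (l - ls) \<bullet> (r - (coupling A xs - c))" by (rule normal_cone_monotone[OF r rs])
  moreover have "((x, \<sigma>, \<mu>, l) - z) \<bullet> (- (v + n + adjoint (coupling A) l - avg_transp \<mu>), - \<mu>, - (avg x - \<sigma>),
      - (r - (coupling A x - c)))
    = - ((x - xs) \<bullet> v) - (x - xs) \<bullet> n - (coupling A x - coupling A xs) \<bullet> l + (avg x - avg xs) \<bullet> \<mu>
      - (\<sigma> - avg xs) \<bullet> \<mu> - \<mu> \<bullet> (avg x - \<sigma>) - (l - ls) \<bullet> (r - (coupling A x - c))"
    unfolding z'
    by (simp add: inner_add_right inner_diff_right[of "x - xs"] adj avt linear_diff[OF linear_coupling]
        linear_diff[OF linear_avg] inner_minus_right del: minus_diff_eq minus_add_distrib)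
  ultimately show ?thesis using e
    by (simp add: inner_diff_left inner_diff_right inner_commute)
qed

text \<open>The vanishing residual makes \<open>v k + n k\<close> and \<open>r k\<close> converge,
  although \<open>v\<close> and \<open>n\<close> may not converge separately. Closedness of the
  graphs of the summed operator and of the orthant's normal cone identifies the limits.\<close>

lemma kkt_limit:
  fixes \<phi> :: "(real ^ 'n) ^ 'N::finite \<Rightarrow> real" and A :: "'N \<Rightarrow> real ^ 'n ^ 'm"
  assumes F: "maximally_monotone (subgrad D \<phi>)"
    and Om: "compact Om" "convex Om"
    and xh: "xh \<in> rel_interior Om" "xh \<in> rel_interior D"
    and mem: "\<And>k. v k \<in> subgrad D \<phi> (x k)" "\<And>k. n k \<in> normal_cone Om (x k)"
      "\<And>k. r k \<in> normal_cone nonneg_orthant (l k)"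
    and lim: "(\<lambda>k. (x k, \<sigma> k, \<mu> k, l k)) \<longlonglongrightarrow> (x', \<sigma>', \<mu>', l')"
    and res: "(\<lambda>k. (- (v k + n k + adjoint (coupling A) (l k) - avg_transp (\<mu> k)), - \<mu> k,
      - (avg (x k) - \<sigma> k), - (r k - (coupling A (x k) - c)))) \<longlonglongrightarrow> 0"
  shows "(x', \<sigma>', \<mu>', l') \<in> kkt_points (subgrad D \<phi>) Om A c"
proof -
  have x: "x \<longlonglongrightarrow> x'" and \<sigma>: "\<sigma> \<longlonglongrightarrow> \<sigma>'" and \<mu>: "\<mu> \<longlonglongrightarrow> \<mu>'" and l: "l \<longlonglongrightarrow> l'"
    using tendsto_fst[OF lim] tendsto_fst[OF tendsto_snd[OF lim]]
      tendsto_fst[OF tendsto_snd[OF tendsto_snd[OF lim]]] tendsto_snd[OF tendsto_snd[OF tendsto_snd[OF lim]]] by simp_all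
  have r1: "(\<lambda>k. v k + n k + adjoint (coupling A) (l k) - avg_transp (\<mu> k)) \<longlonglongrightarrow> 0"
    using tendsto_minus[OF tendsto_fst[OF res]] by (simp add: add.commute)
  have r2: "\<mu> \<longlonglongrightarrow> 0"
    using tendsto_minus[OF tendsto_fst[OF tendsto_snd[OF res]]] by simp
  have r3: "(\<lambda>k. avg (x k) - \<sigma> k) \<longlonglongrightarrow> 0"
    using tendsto_minus[OF tendsto_fst[OF tendsto_snd[OF tendsto_snd[OF res]]]] by simp
  have r4: "(\<lambda>k. r k - (coupling A (x k) - c)) \<longlonglongrightarrow> 0"
    using tendsto_minus[OF tendsto_snd[OF tendsto_snd[OF tendsto_snd[OF res]]]] by simp
  have avx: "(\<lambda>k. avg (x k)) \<longlonglongrightarrow> avg x'"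
    by (rule bounded_linear.tendsto[OF _ x]) (simp add: linear_avg linear_conv_bounded_linear[symmetric])
  have cx: "(\<lambda>k. coupling A (x k)) \<longlonglongrightarrow> coupling A x'"
    by (rule bounded_linear.tendsto[OF _ x]) (simp add: linear_coupling linear_conv_bounded_linear[symmetric])
  have al: "(\<lambda>k. adjoint (coupling A) (l k)) \<longlonglongrightarrow> adjoint (coupling A) l'"
    by (rule bounded_linear.tendsto[OF _ l])
       (simp add: adjoint_linear linear_coupling linear_conv_bounded_linear[symmetric])
  have am: "(\<lambda>k. avg_transp (\<mu> k) :: (real ^ 'n) ^ 'N) \<longlonglongrightarrow> 0"
    by (rule vec_tendstoI) (auto simp: avg_transp_def intro!: tendsto_eq_intros r2)
  have "\<mu>' = 0" using LIMSEQ_unique[OF \<mu> r2] .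
  moreover have "\<sigma>' = avg x'" using LIMSEQ_unique[OF r3 tendsto_diff[OF avx \<sigma>]] by simp
  moreover have "coupling A x' - c \<in> normal_cone nonneg_orthant l'"
  proof (rule normal_cone_limit[OF nonneg_orthant_closed_convex(1) mem(3) _ l])
    show "r \<longlonglongrightarrow> coupling A x' - c"
      using tendsto_add[OF r4 tendsto_diff[OF cx tendsto_const[of c]]] by simp
  qed
  moreover have "(\<lambda>k. v k + n k) \<longlonglongrightarrow> - adjoint (coupling A) l'"
    using tendsto_add[OF tendsto_diff[OF r1 al] am] by simp
  then obtain v' n' where "v' \<in> subgrad D \<phi> x'" "n' \<in> normal_cone Om x'" "v' + n' = - adjoint (coupling A) l'"
    using subgrad_add_normal_cone_limit[OF F Om xh mem(1,2) x] by blast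
  ultimately show ?thesis by (force simp: kkt_points_def)
qed

section \<open>From stationary points to zeros of the operator and equilibria\<close>

text \<open>The witnesses are \<open>p = - g\<close> and \<open>q\<close> with every block
  \<open>- l\<close>; the factor \<open>N\<close> on \<open>l\<close> undoes the division in
  \<open>avg_transp\<close>. On \<open>C_glob\<close>, displacements of \<open>y\<close> are images
  of those of \<open>x\<close>, so pairing with \<open>(p, q)\<close> reduces to pairing with
  \<open>n\<close>.\<close>

lemma kkt_imp_zer_T_op:
  fixes f :: "'N::finite \<Rightarrow> real ^ 'n \<Rightarrow> real ^ 'n \<Rightarrow> ereal"
  assumes kkt: "(x, \<sigma>, \<mu>, l) \<in> kkt_points (\<lambda>v. F_e f v \<sigma>) {x. \<forall>i. x $ i \<in> \<Omega> i} A (\<Sum>i\<in>UNIV. b i)"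
  shows "(x, (\<chi> i. A i *v (x $ i) - b i), \<sigma>, \<mu>, real CARD('N) *\<^sub>R l) \<in> zer (T_op f \<Omega> A b)"
proof -
  let ?Om = "{x. \<forall>i. x $ i \<in> \<Omega> i}"
  let ?y = "\<lambda>x. (\<chi> i. A i *v (x $ i) - b i)"
  obtain g n where \<mu>: "\<mu> = 0" and \<sigma>: "\<sigma> = avg x" and g: "g \<in> F_e f x \<sigma>" and n: "n \<in> normal_cone ?Om x"
    and r: "coupling A x - sum b UNIV \<in> normal_cone nonneg_orthant l"
    and eq: "g + n + adjoint (coupling A) l = 0"
    using kkt by (auto simp: kkt_points_def)
  have x: "x \<in> ?Om" and nle: "\<And>z. z \<in> ?Om \<Longrightarrow> n \<bullet> (z - x) \<le> 0"
    using n by (auto simp: normal_cone_def split: if_splits)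
  have avy: "avg (?y x) = (1 / real CARD('N)) *\<^sub>R (coupling A x - sum b UNIV)"
    by (simp add: avg_def coupling_def sum_subtractf)
  have "avg (?y x) \<in> normal_cone nonneg_orthant (real CARD('N) *\<^sub>R l)"
    using r unfolding avy normal_cone_nonneg_orthant
    by (auto simp: nonneg_orthant_def divide_nonpos_pos)
  moreover have "(- g, - avg_transp (real CARD('N) *\<^sub>R l)) \<in> normal_cone (C_glob \<Omega> A b) (x, ?y x)"
  proof -
    have "(x, ?y x) \<in> C_glob \<Omega> A b" using x by (simp add: C_glob_def C_loc_def)
    moreover have "(- g, - avg_transp (real CARD('N) *\<^sub>R l)) \<bullet> (w - (x, ?y x)) \<le> 0" if "w \<in> C_glob \<Omega> A b" for w
    proof -
      obtain z y where w': "w = (z, y)" by (cases w)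
      have z: "z \<in> ?Om" using that by (simp add: w' C_glob_def C_loc_def)
      have w: "w = (z, ?y z)" using that by (simp add: w' C_glob_def C_loc_def vec_eq_iff)
      have "avg_transp (real CARD('N) *\<^sub>R l) \<bullet> (?y z - ?y x) = l \<bullet> coupling A (z - x)"
        by (simp add: inner_vec_def[of "vec_lambda (\<lambda>i. l)"] avg_transp_def coupling_def inner_sum_right
            matrix_vector_mult_diff_distrib)
      also have "\<dots> = adjoint (coupling A) l \<bullet> (z - x)"
        by (metis adjoint_works[OF linear_coupling] inner_commute)
      finally have "(- g, - avg_transp (real CARD('N) *\<^sub>R l)) \<bullet> (w - (x, ?y x))
        = - ((g + adjoint (coupling A) l) \<bullet> (z - x))"
        by (simp add: w inner_add_left)
      also have "g + adjoint (coupling A) l = (g + n + adjoint (coupling A) l) - n" by simp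
      finally show ?thesis unfolding eq using nle[OF z] by simp
    qed
    ultimately show ?thesis by (simp add: normal_cone_def)
  qed
  moreover have "(0 :: (real ^ 'n) ^ 'N) = g + (- g) - avg_transp \<mu>"
    by (simp add: \<mu> avg_transp_def vec_eq_iff)
  ultimately show ?thesis using g \<sigma> \<mu> unfolding zer_def T_op_def mem_Collect_eq zero_prod_def prod.case
    by (intro exI[of _ g] exI[of _ "- g"] exI[of _ "- avg_transp (real CARD('N) *\<^sub>R l)"] exI[of _ "avg (?y x)"]) simp
qed

text \<open>Since \<open>g\<close> is minus the sum of \<open>n\<close> and the multiplier term, its
  pairing with \<open>z - x\<close> is nonnegative: the first part by the normal cone, the second by
  complementarity at \<open>x\<close> and feasibility of \<open>z\<close>. The equation
  \<open>\<sigma> = avg x\<close> turns \<open>F_e\<close> into \<open>F_a\<close>.\<close>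

lemma kkt_imp_v_GAE:
  assumes kkt: "(x, \<sigma>, \<mu>, l) \<in> kkt_points (\<lambda>v. F_e f v \<sigma>) {x. \<forall>i. x $ i \<in> \<Omega> i} A (\<Sum>i\<in>UNIV. b i)"
  shows "v_GAE f \<Omega> A b x"
proof -
  let ?Om = "{x. \<forall>i. x $ i \<in> \<Omega> i}"
  obtain g n where \<sigma>: "\<sigma> = avg x" and g: "g \<in> F_e f x \<sigma>" and n: "n \<in> normal_cone ?Om x"
    and r: "coupling A x - sum b UNIV \<in> normal_cone nonneg_orthant l"
    and eq: "g + n + adjoint (coupling A) l = 0"
    using kkt by (auto simp: kkt_points_def)
  have l: "l \<in> nonneg_orthant" and le: "\<And>j. (coupling A x - sum b UNIV) $ j \<le> 0"
    and comp: "l \<bullet> (coupling A x - sum b UNIV) = 0"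
    using r by (auto simp: normal_cone_nonneg_orthant)
  have x: "x \<in> ?Om" and nle: "\<And>z. z \<in> ?Om \<Longrightarrow> n \<bullet> (z - x) \<le> 0"
    using n by (auto simp: normal_cone_def split: if_splits)
  have "x \<in> feasible \<Omega> A b" using x le by (simp add: feasible_def coupling_def)
  moreover have "g \<in> F_a f x" using g \<sigma> by (simp add: F_a_def F_e_def)
  moreover have "0 \<le> (z - x) \<bullet> g" if z: "z \<in> feasible \<Omega> A b" for z
  proof -
    have "z \<in> ?Om" and zle: "\<And>j. (coupling A z - sum b UNIV) $ j \<le> 0"
      using z by (auto simp: feasible_def coupling_def)
    have "l \<bullet> (coupling A z - sum b UNIV) \<le> 0"
      unfolding inner_vec_def using l zle
      by (intro sum_nonpos) (simp add: nonneg_orthant_def mult_nonneg_nonpos)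
    moreover have "g = (g + n + adjoint (coupling A) l) - n - adjoint (coupling A) l" by simp
    then have "g = - n - adjoint (coupling A) l" unfolding eq by simp
    then have "(z - x) \<bullet> g = - (n \<bullet> (z - x)) - coupling A (z - x) \<bullet> l"
      by (simp add: inner_diff_right inner_commute[of "z - x" n] adjoint_works[OF linear_coupling])
    moreover have "coupling A (z - x) \<bullet> l = l \<bullet> (coupling A z - sum b UNIV) - l \<bullet> (coupling A x - sum b UNIV)"
      by (simp add: linear_diff[OF linear_coupling] inner_diff_right inner_commute[of _ l])
    ultimately show ?thesis using comp nle[OF \<open>z \<in> ?Om\<close>] by simp
  qed
  ultimately show ?thesis by (auto simp: v_GAE_def solves_GVI_def)
qed

section \<open>The primal step and convergence of the iterates\<close>

text \<open>The resolvent of the stacked problem with block diagonal quadratic part supplies a point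
  whose blocks meet the agents' optimality conditions; uniqueness of the minimisers identifies it
  with \<open>x'\<close>.\<close>

lemma primal_step_inclusion:
  fixes f :: "'N::finite \<Rightarrow> real ^ 'n \<Rightarrow> real ^ 'n \<Rightarrow> ereal"
  assumes fin: "\<And>i u s. f i u s \<noteq> - \<infinity>"
    and F: "maximally_monotone (subgrad D \<phi>)" "\<And>v. F_e f v \<sigma> = subgrad D \<phi> v"
    and Om: "compact {x. \<forall>i. x $ i \<in> \<Omega> i}" "convex {x. \<forall>i. x $ i \<in> \<Omega> i}"
    and xh: "xh \<in> rel_interior {x. \<forall>i. x $ i \<in> \<Omega> i}" "xh \<in> rel_interior D"
    and g: "\<And>i. g i > 0"
    and x': "\<And>i. x' $ i = arg_min_on (\<lambda>z. f i z \<sigma> + ereal (c $ i \<bullet> z +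
        1 / (2 * g i) * wnorm_sq (mat 1 + transpose (A i) ** A i) (z - x $ i))) (\<Omega> i)"
  obtains v n where "v \<in> subgrad D \<phi> x'" "n \<in> normal_cone {x. \<forall>i. x $ i \<in> \<Omega> i} x'"
    "v + n + c + (\<chi> i. precond_block (A i) (g i) ((x' - x) $ i)) = 0"
proof -
  let ?P = "\<lambda>u. \<chi> i. precond_block (A i) (g i) (u $ i)"
  have lin: "linear ?P"
    by (rule linearI) (simp_all add: vec_eq_iff linear_add[OF linear_precond_block] linear_scale[OF linear_precond_block])
  have sym: "u \<bullet> precond_block (A i) (g i) w = precond_block (A i) (g i) u \<bullet> w" for i u w
    by (subst inner_commute[of _ w]) (simp add: inner_precond_block inner_commute)
  have "u \<bullet> ?P w = ?P u \<bullet> w" for u w by (simp add: inner_vec_def[of u] inner_vec_def[of _ w] sym)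
  then obtain z v n where z: "v \<in> subgrad D \<phi> z" "n \<in> normal_cone {x. \<forall>i. x $ i \<in> \<Omega> i} z"
    "v + n + c + ?P (z - x) = 0"
    using resolvent_exists[OF F(1) Om xh lin, of c x] by blast
  have "x' $ i = z $ i" for i
  proof -
    have "v \<in> F_e f z \<sigma>" using F z by simp
    then have "v $ i \<in> subdiff (\<lambda>u. f i u \<sigma>) (z $ i)" by (simp add: F_e_def)
    moreover have "n $ i \<in> normal_cone (\<Omega> i) (z $ i)" by (rule normal_cone_vec_prod_component[OF z(2)])
    moreover have "v $ i + n $ i + c $ i + precond_block (A i) (g i) (z $ i - x $ i) = 0"
      using arg_cong[OF z(3), of "\<lambda>u. u $ i"] by simp
    moreover have "0 < u \<bullet> precond_block (A i) (g i) u" if "u \<noteq> 0" for u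
      using g[of i] that by (simp add: inner_precond_block add_pos_nonneg)
    ultimately show ?thesis
      unfolding x' wnorm_sq_precond_block
      by (intro arg_min_on_regularised) (use fin sym in \<open>auto simp: linear_precond_block\<close>)
  qed
  then have "x' = z" by (simp add: vec_eq_iff)
  with z that show ?thesis by simp
qed

theorem theorem1:
  fixes f :: "'N::finite \<Rightarrow> real ^ 'n \<Rightarrow> real ^ 'n \<Rightarrow> ereal"
    and \<Omega> :: "'N \<Rightarrow> (real ^ 'n) set"
    and A :: "'N \<Rightarrow> real ^ 'n ^ 'm"
    and b :: "'N \<Rightarrow> real ^ 'm"
    and \<gamma> :: "'N \<Rightarrow> real"
    and \<gamma>hat \<alpha> \<delta> \<beta> :: real
    and x :: "nat \<Rightarrow> (real ^ 'n) ^ 'N"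
    and y :: "nat \<Rightarrow> (real ^ 'm) ^ 'N"
    and \<sigma> \<mu> :: "nat \<Rightarrow> real ^ 'n"
    and lam :: "nat \<Rightarrow> real ^ 'm"
  assumes f_not_MInf: "\<And>i u s. f i u s \<noteq> -\<infinity>"
    and Omega: "\<And>i. \<Omega> i \<noteq> {} \<and> compact (\<Omega> i) \<and> convex (\<Omega> i)"
    and slater: "slater f \<Omega> A b"
    and convex_J: "\<And>i z. (\<forall>j\<in>UNIV - {i}. z $ j \<in> \<Omega> j) \<Longrightarrow> convex_fun (\<lambda>u. cost f i u z)"
    and convex_f: "\<And>i w. w \<in> others_avg \<Omega> i \<Longrightarrow> convex_fun (\<lambda>u. f i u w)"
    and max_mono: "maximally_monotone
          (\<lambda>(v, s). F_e f v s \<times> {0})"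
    and gamma: "\<And>i. \<gamma> i > 0"
    and gamma_hat: "\<gamma>hat = (1 / real CARD('N)) * (\<Sum>i\<in>UNIV. \<gamma> i)"
    and alpha: "\<alpha> > 0"
    and delta: "0 < \<delta>" "\<delta> < 1 / \<gamma>hat"
    and beta: "0 < \<beta>" "\<beta> < 1 / (\<alpha> + \<gamma>hat / real CARD('N))"
    and x_init: "\<And>i. x 0 $ i \<in> \<Omega> i"
    and y_init: "\<And>i. y 0 $ i = A i *v (x 0 $ i) - b i"
    and sigma_init: "\<sigma> 0 = avg (x 0)"
    and mu_init: "\<mu> 0 = 0"
    and lam_init: "lam 0 \<in> nonneg_orthant"
    and x_step: "\<And>k i. x (Suc k) $ i =
          arg_min_on
            (\<lambda>z. f i z (\<sigma> k)
               + ereal ((transpose (A i) *v lam k - (1 / real CARD('N)) *\<^sub>R \<mu> k) \<bullet> z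
                        + 1 / (2 * \<gamma> i)
                          * wnorm_sq (mat 1 + transpose (A i) ** A i) (z - x k $ i)))
            (\<Omega> i)"
    and y_step: "\<And>k i. y (Suc k) $ i = A i *v (x (Suc k) $ i) - b i"
    and lam_step: "\<And>k. lam (Suc k) =
          closest_point nonneg_orthant
            (lam k + \<delta> *\<^sub>R (2 *\<^sub>R avg (y (Suc k)) - avg (y k)))"
    and mu_step: "\<And>k. \<mu> (Suc k) =
          \<mu> k - \<beta> *\<^sub>R (2 *\<^sub>R avg (x (Suc k)) - avg (x k) - \<sigma> k + \<alpha> *\<^sub>R \<mu> k)"
    and sigma_step: "\<And>k. \<sigma> (Suc k) = \<sigma> k - \<alpha> *\<^sub>R \<mu> (Suc k)"
  shows "\<exists>x' y' \<sigma>' \<mu>' lam'.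
      (\<lambda>k. (x k, y k, \<sigma> k, \<mu> k, lam k)) \<longlonglongrightarrow> (x', y', \<sigma>', \<mu>', lam') \<and>
      (x', y', \<sigma>', \<mu>', real CARD('N) *\<^sub>R lam') \<in> zer (T_op f \<Omega> A b) \<and>
      v_GAE f \<Omega> A b x'"
proof -
  let ?N = "real CARD('N)"
  let ?Om = "{x. \<forall>i. x $ i \<in> \<Omega> i}"
  let ?c = "\<Sum>i\<in>UNIV. b i"
  obtain xh :: "(real ^ 'n) ^ 'N" where xh: "\<And>i. xh $ i \<in> rel_interior (\<Omega> i)"
    "\<And>i. xh $ i \<in> rel_interior (edom (\<lambda>u. f i u (avg xh)))" "\<And>j. coupling A xh $ j < ?c $ j"
    using slater unfolding slater_def coupling_def by blast
  \<comment> \<open>The aggregate is frozen at the Slater point, where the relative interior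
    condition on the effective domains is known; \<open>F_e\<close> is the same at every other
    aggregate.\<close>
  define D where "D = {x. \<forall>i. x $ i \<in> edom (\<lambda>u. f i u (avg xh))}"
  define \<phi> where "\<phi> x = (\<Sum>i\<in>UNIV. real_of_ereal (f i (x $ i) (avg xh)))" for x :: "(real ^ 'n) ^ 'N"
  have F_e: "F_e f v s = subgrad D \<phi> v" for v s
    unfolding F_e_aggregate_indep[OF max_mono, of v s "avg xh"] D_def \<phi>_def
    by (rule F_e_eq_subgrad) (rule f_not_MInf)
  have F: "maximally_monotone (subgrad D \<phi>)"
    using F_e_maximally_monotone[OF max_mono, of "avg xh"] by (simp add: F_e[abs_def])
  then have mono: "monotone_op (subgrad D \<phi>)" by (simp add: maximally_monotone_def)
  have Om: "compact ?Om" "convex ?Om"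
    using Omega by (auto intro!: compact_vec_prod convex_vec_prod)
  have ri: "xh \<in> rel_interior ?Om" "xh \<in> rel_interior D"
    unfolding D_def using xh by (auto intro!: rel_interior_vec_prod)
  let ?Z = "kkt_points (subgrad D \<phi>) ?Om A ?c"
  let ?\<Phi> = "precond A \<gamma> \<alpha> \<beta> \<delta>"
  define w where "w k = (x k, \<sigma> k, \<mu> k, lam k)" for k

  define R where "R k v n \<longleftrightarrow> v \<in> subgrad D \<phi> (x (Suc k)) \<and> n \<in> normal_cone ?Om (x (Suc k)) \<and>
    v + n + (\<chi> i. transpose (A i) *v lam k - (1 / ?N) *\<^sub>R \<mu> k)
      + (\<chi> i. precond_block (A i) (\<gamma> i) ((x (Suc k) - x k) $ i)) = 0" for k v n
  have "\<exists>v n. R k v n" for k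
  proof -
    have step: "x (Suc k) $ i = arg_min_on (\<lambda>z. f i z (\<sigma> k)
      + ereal ((\<chi> i. transpose (A i) *v lam k - (1 / ?N) *\<^sub>R \<mu> k) $ i \<bullet> z
        + 1 / (2 * \<gamma> i) * wnorm_sq (mat 1 + transpose (A i) ** A i) (z - x k $ i))) (\<Omega> i)" for i
      unfolding vec_lambda_beta by (rule x_step)
    show ?thesis unfolding R_def by (rule primal_step_inclusion[OF f_not_MInf F F_e Om ri gamma step]) blast
  qed
  then obtain v n where "\<And>k. R k (v k) (n k)" by metis
  then have v: "v k \<in> subgrad D \<phi> (x (Suc k))" and n: "n k \<in> normal_cone ?Om (x (Suc k))"
    and eq: "v k + n k + (\<chi> i. transpose (A i) *v lam k - (1 / ?N) *\<^sub>R \<mu> k)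
      + (\<chi> i. precond_block (A i) (\<gamma> i) ((x (Suc k) - x k) $ i)) = 0" for k
    unfolding R_def by blast+

  \<comment> \<open>The initial condition covers \<open>k = 0\<close>, so \<open>y\<close> is a
    function of \<open>x\<close> throughout and can be eliminated.\<close>
  have y: "y k = (\<chi> i. A i *v (x k $ i) - b i)" for k
    by (cases k) (simp_all add: vec_eq_iff y_init y_step)
  have avy: "?N *\<^sub>R avg (y k) = coupling A (x k) - ?c" for k
    by (simp add: y avg_def coupling_def sum_subtractf)
  \<comment> \<open>The projection residual, scaled by \<open>N / \<delta>\<close> to match the dual
    row of \<open>precond\<close>.\<close>
  define r where "r k = (?N / \<delta>) *\<^sub>R (lam k + \<delta> *\<^sub>R (2 *\<^sub>R avg (y (Suc k)) - avg (y k)) - lam (Suc k))" for k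
  have "(nonneg_orthant :: (real ^ 'm) set) \<noteq> {}" using lam_init by blast
  then have r: "r k \<in> normal_cone nonneg_orthant (lam (Suc k))" for k
    unfolding r_def lam_step[of k] using delta(1)
    by (intro normal_cone_scaleR closest_point_normal_cone nonneg_orthant_closed_convex) auto

  \<comment> \<open>The algorithm as a preconditioned proximal step: the negative of an element of
    the reduced operator at the new iterate equals the preconditioned increment.\<close>
  have res: "(- (v k + n k + adjoint (coupling A) (lam (Suc k)) - avg_transp (\<mu> (Suc k))), - \<mu> (Suc k),
      - (avg (x (Suc k)) - \<sigma> (Suc k)), - (r k - (coupling A (x (Suc k)) - ?c)))
    = ?\<Phi> (w (Suc k) - w k)" for k
  proof -
    have "- (v k + n k) = (\<chi> i. transpose (A i) *v lam k - (1 / ?N) *\<^sub>R \<mu> k)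
      + (\<chi> i. precond_block (A i) (\<gamma> i) ((x (Suc k) - x k) $ i))"
      by (rule minus_unique) (use eq[of k] in \<open>simp only: add.assoc\<close>)
    then have "- (v k + n k + adjoint (coupling A) (lam (Suc k)) - avg_transp (\<mu> (Suc k)))
      = (\<chi> i. precond_block (A i) (\<gamma> i) ((x (Suc k) - x k) $ i) - transpose (A i) *v (lam (Suc k) - lam k)
        + (1 / ?N) *\<^sub>R (\<mu> (Suc k) - \<mu> k))"
      by (simp add: adjoint_coupling avg_transp_def vec_eq_iff matrix_vector_mult_diff_distrib algebra_simps
          del: transpose_matrix_vector)
    moreover have "- \<mu> (Suc k) = (\<sigma> (Suc k) - \<sigma> k) /\<^sub>R \<alpha>"
      using alpha by (simp add: sigma_step)
    \<comment> \<open>Replacing \<sigma> by its updated value introduces the new \<mu>, which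
      explains the coefficient \<open>1 / \<beta> - \<alpha>\<close>.\<close>
    moreover have "- (avg (x (Suc k)) - \<sigma> (Suc k)) = (1 / \<beta> - \<alpha>) *\<^sub>R (\<mu> (Suc k) - \<mu> k) + avg (x (Suc k) - x k)"
    proof -
      have "(1 / \<beta>) *\<^sub>R (\<mu> (Suc k) - \<mu> k) = - (2 *\<^sub>R avg (x (Suc k)) - avg (x k) - \<sigma> k + \<alpha> *\<^sub>R \<mu> k)"
        using beta(1) by (simp add: mu_step)
      then show ?thesis
        by (simp add: sigma_step[of k] scaleR_diff_left linear_diff[OF linear_avg] scaleR_2 algebra_simps)
    qed
    moreover have "- (r k - (coupling A (x (Suc k)) - ?c))
      = (?N / \<delta>) *\<^sub>R (lam (Suc k) - lam k) - coupling A (x (Suc k) - x k)"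
    proof -
      have "r k = (?N / \<delta>) *\<^sub>R (lam k - lam (Suc k)) + (2 *\<^sub>R (?N *\<^sub>R avg (y (Suc k))) - ?N *\<^sub>R avg (y k))"
        using delta(1) by (simp add: r_def scaleR_diff_right scaleR_add_right)
      then show ?thesis unfolding avy
        by (simp add: linear_diff[OF linear_coupling] scaleR_2 algebra_simps)
    qed
    ultimately show ?thesis by (simp add: w_def precond_def)
  qed

  \<comment> \<open>A zero comes from minimising over the coupled feasible set with no added term
    \<open>q\<close>; its multiplier is already in the scaling of \<open>kkt_points\<close>.\<close>
  have "?Z \<noteq> {}"
  proof -
    obtain z v n l where "v \<in> subgrad D \<phi> z" "n \<in> normal_cone ?Om z" "l \<in> nonneg_orthant"
      "\<And>j. coupling A z $ j \<le> ?c $ j" "l \<bullet> (coupling A z - ?c) = 0" "v + n + 0 + adjoint (coupling A) l = 0"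
      by (rule constrained_minimiser_multiplier[OF F Om ri linear_coupling xh(3), of "\<lambda>_. 0" "\<lambda>_. 0"]) auto
    then have "(z, avg z, 0, l) \<in> ?Z"
      by (auto simp: kkt_points_def normal_cone_nonneg_orthant)
    then show ?thesis by blast
  qed
  moreover have "(w (Suc k) - z) \<bullet> ?\<Phi> (w (Suc k) - w k) \<le> 0" if "z \<in> ?Z" for z k
    unfolding res[symmetric] by (subst w_def) (rule kkt_fejer[OF mono that v n r])
  \<comment> \<open>Consecutive iterates with a common limit have vanishing preconditioned
    increments, hence vanishing residuals.\<close>
  moreover have "z \<in> ?Z"
    if q: "(\<lambda>k. w (q k)) \<longlonglongrightarrow> z" "(\<lambda>k. w (Suc (q k))) \<longlonglongrightarrow> z" for q z
  proof -
    obtain x' \<sigma>' \<mu>' l' where z: "z = (x', \<sigma>', \<mu>', l')" by (metis prod_cases4)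
    have "(\<lambda>k. ?\<Phi> (w (Suc (q k)) - w (q k))) \<longlonglongrightarrow> ?\<Phi> (z - z)"
      by (rule bounded_linear.tendsto[OF _ tendsto_diff[OF q(2,1)]])
         (simp add: linear_precond linear_conv_bounded_linear[symmetric])
    then have "(\<lambda>k. ?\<Phi> (w (Suc (q k)) - w (q k))) \<longlonglongrightarrow> 0"
      by (simp add: linear_0[OF linear_precond])
    then show ?thesis
      unfolding z res[symmetric]
      by (rule kkt_limit[OF F Om ri v n r, rotated]) (use q(2) in \<open>simp add: w_def z\<close>)
  qed
  ultimately obtain z where z: "z \<in> ?Z" "w \<longlonglongrightarrow> z"
    using preconditioned_proximal_point[of ?\<Phi> ?Z w, OF linear_precond precond_symmetric
        precond_positive[OF gamma gamma_hat alpha delta beta]]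
    by blast
  obtain x' \<sigma>' \<mu>' l' where z': "z = (x', \<sigma>', \<mu>', l')" by (metis prod_cases4)
  have lim: "x \<longlonglongrightarrow> x'" "\<sigma> \<longlonglongrightarrow> \<sigma>'" "\<mu> \<longlonglongrightarrow> \<mu>'" "lam \<longlonglongrightarrow> l'"
    using tendsto_fst[OF z(2)] tendsto_fst[OF tendsto_snd[OF z(2)]]
      tendsto_fst[OF tendsto_snd[OF tendsto_snd[OF z(2)]]] tendsto_snd[OF tendsto_snd[OF tendsto_snd[OF z(2)]]]
    by (simp_all add: w_def z')
  have "(\<lambda>k. A i *v (x k $ i)) \<longlonglongrightarrow> A i *v (x' $ i)" for i
    by (rule bounded_linear.tendsto[OF _ tendsto_vec_nth[OF lim(1)]])
       (simp add: linear_conv_bounded_linear[symmetric])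
  then have "y \<longlonglongrightarrow> (\<chi> i. A i *v (x' $ i) - b i)"
    unfolding y[abs_def] by (intro vec_tendstoI) (auto intro!: tendsto_intros)
  then have "(\<lambda>k. (x k, y k, \<sigma> k, \<mu> k, lam k)) \<longlonglongrightarrow> (x', (\<chi> i. A i *v (x' $ i) - b i), \<sigma>', \<mu>', l')"
    by (intro tendsto_Pair lim)
  \<comment> \<open>Independence of the aggregate allows the inclusion to be read at the limit
    \<sigma>'.\<close>
  moreover have kkt: "(x', \<sigma>', \<mu>', l') \<in> kkt_points (\<lambda>v. F_e f v \<sigma>') ?Om A ?c"
    using z z' by (simp add: F_e)
  ultimately show ?thesis
    using kkt_imp_zer_T_op[OF kkt] kkt_imp_v_GAE[OF kkt] by blast
qed

end
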